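(* Let $P=\mathbb{Q}[x_1,\dots,x_n]$, let $I$ be a zero-dimensional ideal in $P$, let $\sigma$ be a term-ordering on $\mathbb{T}^n$, and let $f\in P$. Let $p_1,p_2$ be two usable primes for $f$ with respect to $(I,\sigma)$, and let $\mu_1=\mu_{\pi_{p_1}(f),I_{(p_1,\sigma)}}(z)$ and $\mu_2=\mu_{\pi_{p_2}(f),I_{(p_2,\sigma)}}(z)$ be the minimal polynomials of the respective modular reductions. (a) If $\deg(\mu_1)<\deg(\mu_2)$ then $p_1$ is a bad prime. (b) If $\deg(\mu_1)=\dim_{\mathbb{Q}}(P/I)$ then $p_1$ is a good prime.
   Context: $\mathbb{T}^n$ is the monoid of power-products in $x_1,\dots,x_n$. An ideal $J$ of a polynomial ring $K[x_1,\dots,x_n]$ over a field $K$ is zero-dimensional if the quotient ring is non-zero and finite-dimensional over $K$. For such $J$ and $g\in K[x_1,\dots,x_n]$, the minimal polynomial $\mu_{g,J}(z)\in K[z]$ is the monic generator of the kernel of the $K$-algebra homomorphism $K[z]\to K[x_1,\dots,x_n]/J$, $z\mapsto g \bmod J$. For $f\in P$, $\mathrm{den}(f)$ is $1$ if $f=0$ and otherwise the least common multiple of the denominators of the coefficients of $f$. If $G$ is the reduced $\sigma$-Gröbner basis of $I$, then $\mathrm{den}_\sigma(I)=\mathrm{lcm}\{\mathrm{den}(g):g\in G\}$. For a positive integer $\delta$, $\mathbb{Z}_\delta\subset\mathbb{Q}$ is the ring of fractions $a/\delta^k$ ($a\in\mathbb{Z}$, $k\in\mathbb{N}$); for a prime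 $p\nmid\delta$, $\pi_p$ denotes the canonical homomorphism $\mathbb{Z}_\delta\to\mathbb{F}_p=\mathbb{Z}/p\mathbb{Z}$ and its coefficientwise extensions to polynomials. A prime $p$ is usable for $f$ with respect to $(I,\sigma)$ if $p$ does not divide $\mathrm{den}(f)\cdot\mathrm{den}_\sigma(I)$. For such $p$, the $(p,\sigma)$-reduction of $I$ is the ideal $I_{(p,\sigma)}=\langle\pi_p(G)\rangle$ of $\mathbb{F}_p[x_1,\dots,x_n]$, which is zero-dimensional; moreover $\mu_{f,I}(z)$ has all its coefficients in $\mathbb{Z}_\delta$ with $\delta=\mathrm{den}(f)\cdot\mathrm{den}_\sigma(I)$, so $\pi_p(\mu_{f,I}(z))$ is defined. A usable prime $p$ is good for $f$ if $\mu_{\pi_p(f),I_{(p,\sigma)}}(z)=\pi_p(\mu_{f,I}(z))$; a usable prime which is not good is called bad. *)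

theory Defs
  imports
    "HOL-Library.Poly_Mapping"
    "HOL-Algebra.Embedded_Algebras"
    "HOL-Algebra.QuotRing"
    "HOL-Algebra.Algebraic_Closure_Type"
    "Berlekamp_Zassenhaus.Finite_Field"
begin


text \<open>
  Power-products in the indeterminates indexed by the finite type \<open>'n\<close> are exponent vectors,
  written additively: \<open>s + t\<close> is the product of power-products and \<open>0\<close> is the power-product 1.
\<close>

type_synonym 'n pp = "'n \<Rightarrow>\<^sub>0 nat"
type_synonym ('n, 'k) mpoly = "'n pp \<Rightarrow>\<^sub>0 'k"

abbreviation P_ring :: "('n, 'k::field) mpoly ring"
  where "P_ring \<equiv> ring_of_type_algebra"

abbreviation Kz_ring :: "'k::field poly ring"
  where "Kz_ring \<equiv> ring_of_type_algebra"

definition const_mpoly :: "'k::field \<Rightarrow> ('n, 'k) mpoly"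
  where "const_mpoly c = Poly_Mapping.single 0 c"

definition residue_class :: "('n, 'k::field) mpoly set \<Rightarrow> ('n, 'k) mpoly \<Rightarrow> ('n, 'k) mpoly set"
  where "residue_class J g = J +>\<^bsub>P_ring\<^esub> g"


section \<open>Zero-dimensional ideals and minimal polynomials\<close>

text \<open>\<open>K[x]/J\<close> is a vector space over the image of the constants, which is a copy of \<open>K\<close>
  when \<open>J\<close> is proper.\<close>

definition scalars_mod :: "('n, 'k::field) mpoly set \<Rightarrow> ('n, 'k) mpoly set set"
  where "scalars_mod J = range (\<lambda>c. residue_class J (const_mpoly c))"

definition quot_dim :: "('n, 'k::field) mpoly set \<Rightarrow> nat"
  where "quot_dim J = ring.dim (P_ring Quot J) (scalars_mod J) (carrier (P_ring Quot J))"

definition zero_dimensional :: "('n, 'k::field) mpoly set \<Rightarrow> bool"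
  where "zero_dimensional J \<longleftrightarrow>
    carrier (P_ring Quot J) \<noteq> {\<zero>\<^bsub>P_ring Quot J\<^esub>} \<and>
    ring.finite_dimension (P_ring Quot J) (scalars_mod J) (carrier (P_ring Quot J))"

definition eval_mod :: "('n, 'k::field) mpoly \<Rightarrow> ('n, 'k) mpoly set \<Rightarrow> 'k poly \<Rightarrow> ('n, 'k) mpoly set"
  where "eval_mod g J q = residue_class J (poly (map_poly const_mpoly q) g)"

definition minimal_poly :: "('n, 'k::field) mpoly \<Rightarrow> ('n, 'k) mpoly set \<Rightarrow> 'k poly"
  where "minimal_poly g J =
    (THE m. lead_coeff m = 1 \<and>
       genideal Kz_ring {m} = a_kernel Kz_ring (P_ring Quot J) (eval_mod g J))"


section \<open>Reduced Groebner bases\<close>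

text \<open>\<open>(s, t) \<in> \<sigma>\<close> means \<open>s \<le> t\<close>.\<close>

definition term_ordering :: "'n pp rel \<Rightarrow> bool"
  where "term_ordering \<sigma> \<longleftrightarrow> linear_order \<sigma> \<and>
    (\<forall>t. (0, t) \<in> \<sigma>) \<and>
    (\<forall>s t u. (s, t) \<in> \<sigma> \<longrightarrow> (s + u, t + u) \<in> \<sigma>)"

definition lead_pp :: "'n pp rel \<Rightarrow> ('n, 'k::field) mpoly \<Rightarrow> 'n pp"
  where "lead_pp \<sigma> g = (THE t. t \<in> Poly_Mapping.keys g \<and> (\<forall>s\<in>Poly_Mapping.keys g. (s, t) \<in> \<sigma>))"

definition LT_ideal :: "'n pp rel \<Rightarrow> ('n, 'k::field) mpoly set \<Rightarrow> ('n, 'k) mpoly set"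
  where "LT_ideal \<sigma> S = genideal P_ring ((\<lambda>g. Poly_Mapping.single (lead_pp \<sigma> g) 1) ` (S - {0}))"

definition groebner_basis :: "'n pp rel \<Rightarrow> ('n, 'k::field) mpoly set \<Rightarrow> ('n, 'k) mpoly set \<Rightarrow> bool"
  where "groebner_basis \<sigma> I G \<longleftrightarrow>
    finite G \<and> 0 \<notin> G \<and> G \<subseteq> I \<and> LT_ideal \<sigma> G = LT_ideal \<sigma> I"

definition is_reduced_gb :: "'n pp rel \<Rightarrow> ('n, 'k::field) mpoly set \<Rightarrow> ('n, 'k) mpoly set \<Rightarrow> bool"
  where "is_reduced_gb \<sigma> I G \<longleftrightarrow> groebner_basis \<sigma> I G \<and>
    (\<forall>g\<in>G. Poly_Mapping.lookup g (lead_pp \<sigma> g) = 1 \<and>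
      (\<forall>t\<in>Poly_Mapping.keys g. Poly_Mapping.single t 1 \<notin> LT_ideal \<sigma> (G - {g})))"

definition reduced_gb :: "'n pp rel \<Rightarrow> ('n, 'k::field) mpoly set \<Rightarrow> ('n, 'k) mpoly set"
  where "reduced_gb \<sigma> I = (THE G. is_reduced_gb \<sigma> I G)"


section \<open>Denominators and reduction modulo a prime\<close>

definition rat_den :: "rat \<Rightarrow> int"
  where "rat_den q = snd (quotient_of q)"

definition den :: "('n, rat) mpoly \<Rightarrow> int"
  where "den f = (if f = 0 then 1
    else Lcm ((\<lambda>t. rat_den (Poly_Mapping.lookup f t)) ` Poly_Mapping.keys f))"

definition den_ideal :: "'n pp rel \<Rightarrow> ('n, rat) mpoly set \<Rightarrow> int"
  where "den_ideal \<sigma> I = Lcm (den ` reduced_gb \<sigma> I)"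

text \<open>
  The prime field with \<open>p\<close> elements is \<open>'p mod_ring\<close>, where \<open>p = CARD('p)\<close>. The homomorphism
  from the ring of fractions \<open>a/\<delta>^k\<close> is extended to a total function on the rationals
  by dividing numerator by denominator; the value is meaningful only if \<open>p\<close> does not divide the
  denominator. On fractions \<open>a/\<delta>^k\<close> with \<open>p\<close> not dividing \<open>\<delta>\<close> it is the canonical map, as shown in
  \<open>rat_mod_frac\<close> below.
\<close>

definition rat_mod :: "rat \<Rightarrow> 'p::prime_card mod_ring"
  where "rat_mod q = of_int (fst (quotient_of q)) / of_int (snd (quotient_of q))"

lemma of_int_mod_ring_eq_0_iff:
  "(of_int x :: 'p::prime_card mod_ring) = 0 \<longleftrightarrow> int CARD('p) dvd x"
  by (transfer, auto)

lemma rat_mod_frac: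
  fixes a \<delta> :: int
  assumes "\<not> int CARD('p::prime_card) dvd \<delta>"
  shows "rat_mod (of_int a / of_int \<delta> ^ k) = (of_int a / of_int \<delta> ^ k :: 'p mod_ring)"
proof -
  obtain m n where mn: "quotient_of (of_int a / of_int \<delta> ^ k) = (m, n)"
    by fastforce
  have "\<delta> \<noteq> 0" using assms by auto
  have n: "n > 0" "coprime m n" "of_int a / of_int \<delta> ^ k = (of_int m / of_int n :: rat)"
    using mn quotient_of_denom_pos quotient_of_coprime quotient_of_div by blast+
  then have "of_int (a * n) = (of_int (m * \<delta> ^ k) :: rat)"
    using \<open>\<delta> \<noteq> 0\<close> by (simp add: field_simps)
  then have eq: "a * n = m * \<delta> ^ k"
    by (simp only: of_int_eq_iff)
  then have "n dvd \<delta> ^ k"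
    using n(2) by (metis coprime_commute coprime_dvd_mult_right_iff dvd_triv_right)
  then have "\<not> int CARD('p) dvd n"
    using assms prime_card_int[where 'a = 'p] by (meson dvd_trans prime_dvd_power)
  then have "(of_int n :: 'p mod_ring) \<noteq> 0" "(of_int \<delta> :: 'p mod_ring) \<noteq> 0"
    using assms by (simp_all add: of_int_mod_ring_eq_0_iff)
  moreover have "(of_int a * of_int n :: 'p mod_ring) = of_int m * of_int \<delta> ^ k"
    using eq by (metis of_int_mult of_int_power)
  ultimately show ?thesis
    by (simp add: rat_mod_def mn field_simps)
qed

definition mpoly_mod :: "('n, rat) mpoly \<Rightarrow> ('n, 'p::prime_card mod_ring) mpoly"
  where "mpoly_mod f = Poly_Mapping.map rat_mod f"

definition poly_mod_p :: "rat poly \<Rightarrow> 'p::prime_card mod_ring poly"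
  where "poly_mod_p h = map_poly rat_mod h"

definition modular_reduction ::
  "'n pp rel \<Rightarrow> ('n, rat) mpoly set \<Rightarrow> ('n, 'p::prime_card mod_ring) mpoly set"
  where "modular_reduction \<sigma> I = genideal P_ring (mpoly_mod ` reduced_gb \<sigma> I)"

definition modular_minimal_poly ::
  "'n pp rel \<Rightarrow> ('n, rat) mpoly set \<Rightarrow> ('n, rat) mpoly \<Rightarrow> 'p::prime_card mod_ring poly"
  where "modular_minimal_poly \<sigma> I f =
    minimal_poly (mpoly_mod f :: ('n, 'p mod_ring) mpoly) (modular_reduction \<sigma> I)"

definition usable_prime :: "nat \<Rightarrow> 'n pp rel \<Rightarrow> ('n, rat) mpoly set \<Rightarrow> ('n, rat) mpoly \<Rightarrow> bool"
  where "usable_prime p \<sigma> I f \<longleftrightarrow> prime p \<and> \<not> int p dvd den f * den_ideal \<sigma> I"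

definition good_prime ::
  "'p::prime_card itself \<Rightarrow> 'n pp rel \<Rightarrow> ('n, rat) mpoly set \<Rightarrow> ('n, rat) mpoly \<Rightarrow> bool"
  where "good_prime TYPE('p) \<sigma> I f \<longleftrightarrow> usable_prime CARD('p) \<sigma> I f \<and>
    (modular_minimal_poly \<sigma> I f :: 'p mod_ring poly) = poly_mod_p (minimal_poly f I)"

definition bad_prime ::
  "'p::prime_card itself \<Rightarrow> 'n pp rel \<Rightarrow> ('n, rat) mpoly set \<Rightarrow> ('n, rat) mpoly \<Rightarrow> bool"
  where "bad_prime TYPE('p) \<sigma> I f \<longleftrightarrow>
    usable_prime CARD('p) \<sigma> I f \<and> \<not> good_prime TYPE('p) \<sigma> I f"

end

theory Submission
  imports Defs "Jordan_Normal_Form.Char_Poly"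
begin

text \<open>
  Write \<open>\<mu>\<close> for the minimal polynomial of \<open>f\<close> modulo the rational ideal \<open>I\<close>. Everything
  follows from one fact about a usable prime \<open>p\<close>, \<open>modular_minimal_poly_dvd\<close>: the
  coefficients of \<open>\<mu>\<close> have denominators prime to \<open>p\<close>, and the modular minimal polynomial
  divides the reduction of \<open>\<mu>\<close> modulo \<open>p\<close>. Both polynomials are monic and reduction preserves
  the degree of \<open>\<mu>\<close>. So the degree of a modular minimal polynomial is at most the degree of
  \<open>\<mu>\<close>, with equality exactly for good primes. If it is smaller for \<open>p1\<close> than for \<open>p2\<close>, it
  is smaller than the degree of \<open>\<mu>\<close>, and \<open>p1\<close> is bad. The degree of \<open>\<mu>\<close> is in turn
  at most the dimension of the quotient by \<open>I\<close>, as the powers of \<open>f\<close> below it are linearly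
  independent; if the degree at \<open>p1\<close> reaches that dimension, all three numbers agree and \<open>p1\<close>
  is good.

  The fact about \<open>p\<close> rests on division by the reduced Groebner basis. The basis is monic and its
  denominators are prime to \<open>p\<close>, so division never leaves the local ring of the integers at \<open>p\<close>
  (\<open>division_by_reduced_gb\<close>). This is used twice. Firstly, multiplication by \<open>f\<close> has a matrix
  over the local ring with respect to the finitely many standard power-products, whose
  characteristic polynomial is a monic equation for \<open>f\<close> modulo \<open>I\<close> (\<open>ex_integral_equation\<close>);
  its factor \<open>\<mu>\<close> has coefficients in the local ring by Gauss's lemma (\<open>monic_factor_over\<close>).
  Secondly, division writes \<open>\<mu>(f)\<close>, an element of \<open>I\<close>, as a combination of the basis with
  coefficients in the local ring, and reducing this identity modulo \<open>p\<close> shows that the reduction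
  of \<open>\<mu>\<close> annihilates the reduction of \<open>f\<close>.

  As \<open>reduced_gb\<close> is a definite description, existence and uniqueness of the reduced
  Groebner basis are proved first, from Dickson's lemma and division.
\<close>

section \<open>Polynomials in several indeterminates\<close>

lemma mpoly_eq_sum_single: "g = (\<Sum>t\<in>Poly_Mapping.keys g. Poly_Mapping.single t (Poly_Mapping.lookup g t))"
  by (rule poly_mapping_eqI) (auto simp: lookup_sum lookup_single when_def in_keys_iff)

lemma lookup_single_mult:
  fixes g :: "('n, 'k::field) mpoly"
  shows "Poly_Mapping.lookup (Poly_Mapping.single u c * g) (u + s) = c * Poly_Mapping.lookup g s"
proof -
  have "Poly_Mapping.single u c * g
      = (\<Sum>t\<in>Poly_Mapping.keys g. Poly_Mapping.single (u + t) (c * Poly_Mapping.lookup g t))"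
    by (subst mpoly_eq_sum_single[of g]) (simp add: sum_distrib_left mult_single)
  then show ?thesis
    by (auto simp: lookup_sum lookup_single when_def in_keys_iff)
qed

lemma keys_single_mult:
  fixes g :: "('n, 'k::field) mpoly"
  assumes "t \<in> Poly_Mapping.keys (Poly_Mapping.single u c * g)"
  obtains s where "t = u + s" "s \<in> Poly_Mapping.keys g"
  using keys_mult[of "Poly_Mapping.single u c" g] assms by (auto split: if_splits)

lemma ring_of_type_algebra_simps [simp]:
  "carrier ring_of_type_algebra = UNIV"
  "\<zero>\<^bsub>ring_of_type_algebra\<^esub> = 0" "\<one>\<^bsub>ring_of_type_algebra\<^esub> = 1"
  "a \<oplus>\<^bsub>ring_of_type_algebra\<^esub> b = a + b" "a \<otimes>\<^bsub>ring_of_type_algebra\<^esub> b = a * b"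
  by (simp_all add: ring_of_type_algebra_def)

lemma cring_P_ring: "cring (P_ring :: ('n, 'k::field) mpoly ring)"
  and ring_P_ring: "ring (P_ring :: ('n, 'k::field) mpoly ring)"
  and cring_Kz_ring: "cring (Kz_ring :: 'k::field poly ring)"
  using cring_from_type_algebra ring_from_type_algebra by blast+

lemma a_inv_P_ring [simp]: "\<ominus>\<^bsub>P_ring\<^esub> a = - (a :: ('n, 'k::field) mpoly)"
proof -
  interpret cring "P_ring :: ('n, 'k) mpoly ring" by (rule cring_P_ring)
  show ?thesis by (rule minus_equality) simp_all
qed

lemma ideal_P_ringI:
  fixes J :: "('n, 'k::field) mpoly set"
  assumes "0 \<in> J" "\<And>a b. a \<in> J \<Longrightarrow> b \<in> J \<Longrightarrow> a + b \<in> J" "\<And>a x. a \<in> J \<Longrightarrow> x * a \<in> J"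
  shows "ideal J P_ring"
proof (rule idealI[OF ring_P_ring])
  have "- a \<in> J" if "a \<in> J" for a
    using assms(3)[OF that, of "-1"] by simp
  then show "subgroup J (add_monoid (P_ring :: ('n, 'k) mpoly ring))"
    using assms(1,2) a_inv_P_ring[where 'n = 'n and 'k = 'k]
    by (intro group.subgroupI[OF abelian_group.a_group[OF ring.is_abelian_group[OF ring_P_ring]]])
       (auto simp: a_inv_def)
qed (use assms(3) in \<open>auto simp: mult.commute\<close>)

locale mpoly_ideal =
  fixes J :: "('n, 'k::field) mpoly set"
  assumes ideal_J: "ideal J P_ring"
begin

lemma zero_mem: "0 \<in> J"
  using additive_subgroup.zero_closed[OF ideal.axioms(1)[OF ideal_J]] by simp

lemma add_mem: "a \<in> J \<Longrightarrow> b \<in> J \<Longrightarrow> a + b \<in> J"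
  using additive_subgroup.a_closed[OF ideal.axioms(1)[OF ideal_J]] by simp

lemma mult_mem: "a \<in> J \<Longrightarrow> x * a \<in> J"
  using ideal.I_l_closed[OF ideal_J] by simp

lemma minus_mem: "a \<in> J \<Longrightarrow> b \<in> J \<Longrightarrow> a - b \<in> J"
  using add_mem[of a "(-1) * b"] mult_mem[of b "-1"] by simp

lemma sum_mem: "(\<And>i. i \<in> A \<Longrightarrow> h i \<in> J) \<Longrightarrow> sum h A \<in> J"
  by (induction A rule: infinite_finite_induct) (auto intro: zero_mem add_mem)

lemma residue_class_eq_iff: "residue_class J a = residue_class J b \<longleftrightarrow> a - b \<in> J"
proof -
  interpret ideal J P_ring by (rule ideal_J)
  show ?thesis
    using quotient_eq_iff_same_a_r_cos[OF ideal_J, of a b]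
    by (simp add: residue_class_def a_minus_def)
qed

lemma residue_class_eq_zero_iff: "residue_class J a = \<zero>\<^bsub>P_ring Quot J\<^esub> \<longleftrightarrow> a \<in> J"
  using residue_class_eq_iff[of a 0] ring_hom_zero[OF ideal.rcos_ring_hom[OF ideal_J] ring_P_ring ideal.quotient_is_ring[OF ideal_J]]
  by (simp add: residue_class_def)

end


section \<open>Coefficient rings\<close>

text \<open>A subring of the coefficient field. Two cases are needed: the whole field, for the existence of
the reduced Groebner basis, and the rationals whose denominator is prime to \<open>p\<close>, where
reduction modulo \<open>p\<close> makes sense.\<close>

locale coeff_ring =
  fixes R :: "'k::field set"
  assumes one_R: "1 \<in> R"
    and diff_R: "a \<in> R \<Longrightarrow> b \<in> R \<Longrightarrow> a - b \<in> R"
    and mult_R: "a \<in> R \<Longrightarrow> b \<in> R \<Longrightarrow> a * b \<in> R"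
begin

lemma zero_R: "0 \<in> R"
  using diff_R[OF one_R one_R] by simp

lemma uminus_R: "a \<in> R \<Longrightarrow> - a \<in> R"
  using diff_R[OF zero_R] by simp

lemma add_R: "a \<in> R \<Longrightarrow> b \<in> R \<Longrightarrow> a + b \<in> R"
  using diff_R[OF _ uminus_R, of a b] by simp

lemma sum_R: "(\<And>i. i \<in> A \<Longrightarrow> h i \<in> R) \<Longrightarrow> sum h A \<in> R"
  by (induction A rule: infinite_finite_induct) (auto intro: zero_R add_R)

definition mpolys_over :: "('n, 'k) mpoly set"
  where "mpolys_over = {h. \<forall>t. Poly_Mapping.lookup h t \<in> R}"

definition polys_over :: "'k poly set"
  where "polys_over = {q. \<forall>i. coeff q i \<in> R}"

lemma mpolys_overD: "h \<in> mpolys_over \<Longrightarrow> Poly_Mapping.lookup h t \<in> R"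
  by (simp add: mpolys_over_def)

lemma single_over: "c \<in> R \<Longrightarrow> Poly_Mapping.single t c \<in> mpolys_over"
  by (auto simp: mpolys_over_def lookup_single when_def zero_R)

lemma add_over: "a \<in> mpolys_over \<Longrightarrow> b \<in> mpolys_over \<Longrightarrow> a + b \<in> mpolys_over"
  by (simp add: mpolys_over_def lookup_add add_R)

lemma minus_over: "a \<in> mpolys_over \<Longrightarrow> b \<in> mpolys_over \<Longrightarrow> a - b \<in> mpolys_over"
  by (simp add: mpolys_over_def lookup_minus diff_R)

lemma sum_over: "(\<And>i. i \<in> A \<Longrightarrow> h i \<in> mpolys_over) \<Longrightarrow> sum h A \<in> mpolys_over"
  by (simp add: mpolys_over_def lookup_sum sum_R)

lemma mult_over:
  assumes "a \<in> mpolys_over" "b \<in> mpolys_over"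
  shows "a * b \<in> mpolys_over"
proof -
  have "a * b = (\<Sum>s\<in>Poly_Mapping.keys a. \<Sum>t\<in>Poly_Mapping.keys b.
      Poly_Mapping.single (s + t) (Poly_Mapping.lookup a s * Poly_Mapping.lookup b t))"
    by (subst mpoly_eq_sum_single[of a], subst mpoly_eq_sum_single[of b])
       (simp add: sum_product mult_single)
  then show ?thesis
    using assms by (auto intro!: sum_over single_over mult_R mpolys_overD)
qed

lemma add_polys_over: "a \<in> polys_over \<Longrightarrow> b \<in> polys_over \<Longrightarrow> a + b \<in> polys_over"
  by (simp add: polys_over_def add_R)

lemma mult_polys_over: "a \<in> polys_over \<Longrightarrow> b \<in> polys_over \<Longrightarrow> a * b \<in> polys_over"
  by (simp add: polys_over_def coeff_mult sum_R mult_R)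

lemma sum_polys_over: "(\<And>i. i \<in> A \<Longrightarrow> h i \<in> polys_over) \<Longrightarrow> sum h A \<in> polys_over"
  by (simp add: polys_over_def coeff_sum sum_R)

lemma const_polys_over: "c \<in> R \<Longrightarrow> [:c:] \<in> polys_over"
  by (auto simp: polys_over_def coeff_pCons zero_R split: nat.splits)

lemma prod_polys_over: "(\<And>i. i \<in> A \<Longrightarrow> h i \<in> polys_over) \<Longrightarrow> prod h A \<in> polys_over"
  by (induction A rule: infinite_finite_induct)
     (auto intro: mult_polys_over const_polys_over[OF one_R, unfolded one_pCons[symmetric]])

text \<open>The ideal generated by \<open>G\<close> in the polynomials with coefficients in \<open>R\<close>. The inductive form
matches the steps of the division algorithm, and properties that are additive and compatible with
monomial multiples follow by induction.\<close>

inductive_set combinations :: "('n, 'k) mpoly set \<Rightarrow> ('n, 'k) mpoly set"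
  for G :: "('n, 'k) mpoly set"
  where
    zero: "0 \<in> combinations G"
  | step: "h \<in> combinations G \<Longrightarrow> c \<in> R \<Longrightarrow> g \<in> G \<Longrightarrow> h + Poly_Mapping.single t c * g \<in> combinations G"

lemma combinations_subset_ideal:
  assumes "ideal J P_ring" "G \<subseteq> J" "h \<in> combinations G"
  shows "h \<in> J"
  using assms(3)
proof induction
  case (step h c g t)
  interpret mpoly_ideal J by (rule mpoly_ideal.intro[OF assms(1)])
  show ?case using step assms(2) by (auto intro: add_mem mult_mem)
qed (rule mpoly_ideal.zero_mem[OF mpoly_ideal.intro[OF assms(1)]])

end

interpretation full: coeff_ring UNIV
  by unfold_locales auto


section \<open>Power-products and term orderings\<close>

text \<open>Divisibility of power-products in additive notation. The order that the library puts on finitely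
supported functions is lexicographic, not this one.\<close>

definition adds :: "'n pp \<Rightarrow> 'n pp \<Rightarrow> bool"  (infix \<open>adds\<close> 50)
  where "s adds t \<longleftrightarrow> (\<exists>u. t = s + u)"

lemma adds_iff_lookup: "s adds t \<longleftrightarrow> (\<forall>i. Poly_Mapping.lookup s i \<le> Poly_Mapping.lookup t i)"
proof
  assume "\<forall>i. Poly_Mapping.lookup s i \<le> Poly_Mapping.lookup t i"
  then have "t = s + (t - s)"
    by (intro poly_mapping_eqI) (simp add: lookup_add lookup_minus)
  then show "s adds t" unfolding adds_def by blast
qed (auto simp: adds_def lookup_add)

lemma adds_refl: "t adds t"
  by (simp add: adds_iff_lookup)

lemma adds_trans: "s adds t \<Longrightarrow> t adds u \<Longrightarrow> s adds u"
  unfolding adds_iff_lookup using order_trans by blast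

lemma adds_antisym: "s adds t \<Longrightarrow> t adds s \<Longrightarrow> s = t"
  unfolding adds_iff_lookup by (intro poly_mapping_eqI) (simp add: order_antisym)

lemma nat_seq_incseq_subseq:
  fixes s :: "nat \<Rightarrow> nat"
  obtains \<phi> where "strict_mono \<phi>" "incseq (s \<circ> \<phi>)"
proof -
  obtain \<phi> where \<phi>: "strict_mono \<phi>" "monoseq (\<lambda>n. s (\<phi> n))"
    using seq_monosub by blast
  show thesis
  proof (cases "incseq (\<lambda>n. s (\<phi> n))")
    case True
    with \<phi>(1) that show ?thesis by (simp add: comp_def)
  next
    case False
    with \<phi>(2) have dec: "decseq (\<lambda>n. s (\<phi> n))" by (auto simp: monoseq_iff)
    \<comment> \<open>A decreasing sequence of naturals is constant from the place of its minimum on.\<close>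
    define N where "N = (ARG_MIN (\<lambda>n. s (\<phi> n)) n. True)"
    have min: "s (\<phi> N) \<le> s (\<phi> n)" for n
      unfolding N_def by (rule arg_min_nat_le) simp
    have "s (\<phi> (N + n)) = s (\<phi> N)" for n
      using decseqD[OF dec, of N "N + n"] min[of "N + n"] by simp
    then have "incseq (s \<circ> (\<lambda>n. \<phi> (N + n)))" by (simp add: incseq_def)
    moreover have "strict_mono (\<lambda>n. \<phi> (N + n))"
      using \<phi>(1) by (simp add: strict_mono_def)
    ultimately show ?thesis by (rule that[rotated])
  qed
qed

text \<open>Dickson's lemma: passing to a monotone subsequence once for each indeterminate makes all
exponents monotone at the same time.\<close>

lemma dickson:
  fixes s :: "nat \<Rightarrow> 'n::finite pp"
  obtains i j where "i < j" "s i adds s j"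
proof -
  have "\<exists>\<phi>. strict_mono \<phi> \<and> (\<forall>i\<in>A. incseq (\<lambda>n. Poly_Mapping.lookup (s (\<phi> n)) i))"
    if "finite A" for A
    using that
  proof induction
    case empty
    show ?case using strict_mono_id by blast
  next
    case (insert a A)
    then obtain \<phi> where \<phi>: "strict_mono \<phi>" "\<forall>i\<in>A. incseq (\<lambda>n. Poly_Mapping.lookup (s (\<phi> n)) i)"
      by blast
    obtain \<psi> where \<psi>: "strict_mono \<psi>" "incseq ((\<lambda>n. Poly_Mapping.lookup (s (\<phi> n)) a) \<circ> \<psi>)"
      by (rule nat_seq_incseq_subseq)
    have "strict_mono (\<phi> \<circ> \<psi>)" by (rule strict_mono_o[OF \<phi>(1) \<psi>(1)])
    moreover have "incseq (\<lambda>n. Poly_Mapping.lookup (s ((\<phi> \<circ> \<psi>) n)) i)" if "i \<in> A" for i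
      using \<phi>(2) that \<psi>(1) by (auto simp: incseq_def strict_mono_less_eq)
    ultimately show ?case using \<psi>(2) by (auto simp: comp_def intro!: exI[of _ "\<phi> \<circ> \<psi>"])
  qed
  from this[OF finite_class.finite_UNIV] obtain \<phi>
    where \<phi>: "strict_mono \<phi>" "\<And>i. incseq (\<lambda>n. Poly_Mapping.lookup (s (\<phi> n)) i)"
    by auto
  have "s (\<phi> 0) adds s (\<phi> 1)"
    unfolding adds_iff_lookup using \<phi>(2) by (auto simp: incseq_def)
  moreover have "\<phi> 0 < \<phi> 1" using \<phi>(1) by (simp add: strict_mono_def)
  ultimately show thesis using that by blast
qed

lemma finite_adds_antichain:
  fixes A :: "'n::finite pp set"
  assumes "\<And>s t. s \<in> A \<Longrightarrow> t \<in> A \<Longrightarrow> s adds t \<Longrightarrow> s = t"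
  shows "finite A"
proof (rule ccontr)
  assume "infinite A"
  then obtain s :: "nat \<Rightarrow> 'n pp" where s: "inj s" "range s \<subseteq> A"
    using infinite_countable_subset by blast
  obtain i j where ij: "i < j" "s i adds s j" by (rule dickson)
  with assms s show False by (metis injD less_irrefl rangeI subsetD)
qed

locale pp_order =
  fixes \<sigma> :: "'n::finite pp rel"
  assumes ord: "term_ordering \<sigma>"
begin

lemma refl_\<sigma>: "(t, t) \<in> \<sigma>"
  and antisym_\<sigma>: "(s, t) \<in> \<sigma> \<Longrightarrow> (t, s) \<in> \<sigma> \<Longrightarrow> s = t"
  and trans_\<sigma>: "(s, t) \<in> \<sigma> \<Longrightarrow> (t, u) \<in> \<sigma> \<Longrightarrow> (s, u) \<in> \<sigma>"
  and total_\<sigma>: "(s, t) \<in> \<sigma> \<or> (t, s) \<in> \<sigma>"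
  and add_\<sigma>: "(s, t) \<in> \<sigma> \<Longrightarrow> (u + s, u + t) \<in> \<sigma>"
  and zero_\<sigma>: "(0, t) \<in> \<sigma>"
  using ord unfolding term_ordering_def linear_order_on_def partial_order_on_def preorder_on_def
    refl_on_def antisym_def trans_def total_on_def
  by (auto simp: add.commute[of u]) metis

lemma adds_imp_\<sigma>: "s adds t \<Longrightarrow> (s, t) \<in> \<sigma>"
  using add_\<sigma>[OF zero_\<sigma>, of s] by (auto simp: adds_def)

text \<open>In an infinite descending chain some member would divide a later one, by Dickson's lemma, and so
be smaller than it.\<close>

lemma wf_\<sigma>: "wf (\<sigma> - Id)"
  unfolding wf_iff_no_infinite_down_chain
proof
  assume "\<exists>f. \<forall>i. (f (Suc i), f i) \<in> \<sigma> - Id"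
  then obtain f where f: "\<And>i. (f (Suc i), f i) \<in> \<sigma>" "\<And>i. f (Suc i) \<noteq> f i" by auto
  have desc: "(f (i + k), f i) \<in> \<sigma>" for i k
    by (induction k) (auto intro: refl_\<sigma> trans_\<sigma> f(1))
  obtain i j where ij: "i < j" "f i adds f j" by (rule dickson)
  obtain k where k: "j = Suc i + k" using less_imp_Suc_add[OF ij(1)] by auto
  have "(f i, f (Suc i)) \<in> \<sigma>"
    using desc[of "Suc i" k] adds_imp_\<sigma>[OF ij(2)] k by (auto intro: trans_\<sigma>)
  with f antisym_\<sigma> show False by metis
qed

lemma ex_max_\<sigma>:
  assumes "finite A" "A \<noteq> {}"
  shows "\<exists>t\<in>A. \<forall>s\<in>A. (s, t) \<in> \<sigma>"
  using assms
proof (induction rule: finite_ne_induct)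
  case (insert a A)
  then obtain t where "t \<in> A" "\<forall>s\<in>A. (s, t) \<in> \<sigma>" by blast
  then show ?case using total_\<sigma>[of a t] refl_\<sigma> trans_\<sigma> by (metis insert_iff)
qed (auto intro: refl_\<sigma>)

lemma lead_ppI:
  assumes "t \<in> Poly_Mapping.keys g" "\<And>s. s \<in> Poly_Mapping.keys g \<Longrightarrow> (s, t) \<in> \<sigma>"
  shows "lead_pp \<sigma> g = t"
  unfolding lead_pp_def using assms antisym_\<sigma> by (intro the_equality) auto

lemma lead_pp:
  assumes "g \<noteq> 0"
  shows lead_pp_in_keys: "lead_pp \<sigma> g \<in> Poly_Mapping.keys g"
    and keys_le_lead_pp: "s \<in> Poly_Mapping.keys g \<Longrightarrow> (s, lead_pp \<sigma> g) \<in> \<sigma>"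
proof -
  obtain t where "t \<in> Poly_Mapping.keys g" "\<forall>s\<in>Poly_Mapping.keys g. (s, t) \<in> \<sigma>"
    using ex_max_\<sigma>[of "Poly_Mapping.keys g"] assms by auto
  with lead_ppI[of t g]
  show "lead_pp \<sigma> g \<in> Poly_Mapping.keys g" "s \<in> Poly_Mapping.keys g \<Longrightarrow> (s, lead_pp \<sigma> g) \<in> \<sigma>"
    by auto
qed

lemma lead_pp_single_mult:
  fixes g :: "('n, 'k::field) mpoly"
  assumes "g \<noteq> 0" "c \<noteq> 0"
  shows "lead_pp \<sigma> (Poly_Mapping.single u c * g) = u + lead_pp \<sigma> g"
    and "Poly_Mapping.single u c * g \<noteq> 0"
proof -
  have k: "u + lead_pp \<sigma> g \<in> Poly_Mapping.keys (Poly_Mapping.single u c * g)"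
    using lead_pp_in_keys[OF assms(1)] assms(2) by (simp add: in_keys_iff lookup_single_mult)
  then show "lead_pp \<sigma> (Poly_Mapping.single u c * g) = u + lead_pp \<sigma> g"
    by (rule lead_ppI) (auto elim!: keys_single_mult intro: add_\<sigma> keys_le_lead_pp[OF assms(1)])
  show "Poly_Mapping.single u c * g \<noteq> 0" using k by auto
qed


section \<open>Division with remainder\<close>

lemma keys_minus_cancel:
  fixes h g :: "('n, 'k::field) mpoly"
  assumes "\<And>s. s \<in> Poly_Mapping.keys h \<Longrightarrow> (s, t) \<in> \<sigma>"
    and "\<And>s. s \<in> Poly_Mapping.keys g \<Longrightarrow> (s, t) \<in> \<sigma>"
    and "Poly_Mapping.lookup h t = Poly_Mapping.lookup g t" "s \<in> Poly_Mapping.keys (h - g)"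
  shows "(s, t) \<in> \<sigma> - Id"
proof -
  have "s \<in> Poly_Mapping.keys h \<or> s \<in> Poly_Mapping.keys g" "s \<noteq> t"
    using assms(3,4) by (auto simp: in_keys_iff lookup_minus)
  then show ?thesis using assms(1,2) by auto
qed

text \<open>Division with remainder. As every divisor is monic, each step only multiplies and subtracts
coefficients of \<open>h\<close> and \<open>G\<close>, so quotients and remainder stay over \<open>R\<close>. The
induction runs over a bound for the support of \<open>h\<close>: a step cancels the coefficient at the
bound, either by a multiple of some \<open>g\<close> or by moving that monomial into the remainder.\<close>

lemma division:
  fixes G :: "('n, 'k::field) mpoly set"
  assumes "coeff_ring R"
    and G: "0 \<notin> G" "\<And>g. g \<in> G \<Longrightarrow> Poly_Mapping.lookup g (lead_pp \<sigma> g) = 1"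
      "G \<subseteq> coeff_ring.mpolys_over R"
    and h: "h \<in> coeff_ring.mpolys_over R"
  obtains r where "r \<in> coeff_ring.mpolys_over R" "h - r \<in> coeff_ring.combinations R G"
    "\<And>t g. t \<in> Poly_Mapping.keys r \<Longrightarrow> g \<in> G \<Longrightarrow> \<not> lead_pp \<sigma> g adds t"
proof -
  interpret coeff_ring R by fact
  let ?rem = "\<lambda>h r. r \<in> mpolys_over \<and> h - r \<in> combinations G \<and>
    (\<forall>t\<in>Poly_Mapping.keys r. \<forall>g\<in>G. \<not> lead_pp \<sigma> g adds t)"
  have "\<forall>h\<in>mpolys_over. (\<forall>s\<in>Poly_Mapping.keys h. (s, t) \<in> \<sigma>) \<longrightarrow> (\<exists>r. ?rem h r)" for t
    using wf_\<sigma>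
  proof (induction t)
    case (less t)
    show ?case
    proof (intro ballI impI)
      fix h :: "('n, 'k) mpoly"
      assume h: "h \<in> mpolys_over" "\<forall>s\<in>Poly_Mapping.keys h. (s, t) \<in> \<sigma>"
      define c where "c = Poly_Mapping.lookup h t"
      have c: "c \<in> R" using h(1) by (simp add: c_def mpolys_overD)
      have smaller: "\<exists>r. ?rem h' r"
        if h': "h' \<in> mpolys_over" "\<And>s. s \<in> Poly_Mapping.keys h' \<Longrightarrow> (s, t) \<in> \<sigma> - Id" for h'
      proof (cases "h' = 0")
        case True
        then show ?thesis using h'(1) by (intro exI[of _ 0]) (auto intro: combinations.zero)
      next
        case False
        with less[OF h'(2)[OF lead_pp_in_keys]] h'(1) keys_le_lead_pp show ?thesis by auto
      qed
      show "\<exists>r. ?rem h r"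
      proof (cases "\<exists>g\<in>G. lead_pp \<sigma> g adds t")
        case True
        then obtain g u where g: "g \<in> G" "t = u + lead_pp \<sigma> g"
          unfolding adds_def by (metis add.commute)
        have g0: "g \<noteq> 0" using g(1) G(1) by auto
        let ?m = "Poly_Mapping.single u c * g"
        have "Poly_Mapping.lookup ?m t = c"
          using G(2)[OF g(1)] by (simp add: g(2) lookup_single_mult)
        moreover have "(s, t) \<in> \<sigma>" if "s \<in> Poly_Mapping.keys ?m" for s
          using that unfolding g(2) by (auto elim!: keys_single_mult intro: add_\<sigma> keys_le_lead_pp[OF g0])
        moreover have "?m \<in> mpolys_over"
          using G(3) g(1) c by (auto intro: mult_over single_over)
        ultimately have "\<exists>r. ?rem (h - ?m) r"
          using h by (intro smaller minus_over keys_minus_cancel[of h t ?m]) (auto simp: c_def)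
        then obtain r where r: "?rem (h - ?m) r" by blast
        then have "(h - ?m - r) + ?m \<in> combinations G"
          using g(1) c by (blast intro: combinations.step)
        then have "?rem h r" using r by (simp add: algebra_simps)
        then show ?thesis by blast
      next
        case False
        let ?m = "Poly_Mapping.single t c"
        have m: "?m \<in> mpolys_over" using c by (rule single_over)
        have "\<exists>r. ?rem (h - ?m) r"
          using h m by (intro smaller minus_over keys_minus_cancel[of h t ?m])
            (auto simp: c_def refl_\<sigma> split: if_splits)
        then obtain r where r: "?rem (h - ?m) r" by blast
        have "\<forall>s\<in>Poly_Mapping.keys (r + ?m). \<forall>g\<in>G. \<not> lead_pp \<sigma> g adds s"
          using r False keys_add[of r ?m] by (fastforce split: if_splits)
        then have "?rem h (r + ?m)"
          using r m add_over[of r ?m] by (simp add: algebra_simps)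
        then show ?thesis by blast
      qed
    qed
  qed
  moreover have "\<exists>t. \<forall>s\<in>Poly_Mapping.keys h. (s, t) \<in> \<sigma>"
    using ex_max_\<sigma>[of "Poly_Mapping.keys h"] by (cases "h = 0") auto
  ultimately have "\<exists>r. ?rem h r" using h by blast
  then show thesis using that by blast
qed

end

section \<open>The reduced Groebner basis\<close>

definition lead_pps :: "'n pp rel \<Rightarrow> ('n, 'k::field) mpoly set \<Rightarrow> 'n pp set"
  where "lead_pps \<sigma> S = lead_pp \<sigma> ` (S - {0})"

lemma adds_add: "s adds t \<Longrightarrow> s adds u + t"
  by (simp add: adds_iff_lookup lookup_add trans_le_add2)

text \<open>Membership in a monomial ideal is divisibility by a generator, because the polynomials all of
whose power-products are divisible by a generator already form an ideal.\<close>

lemma single_in_LT_ideal_iff: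
  fixes S :: "('n, 'k::field) mpoly set"
  shows "Poly_Mapping.single t 1 \<in> LT_ideal \<sigma> S \<longleftrightarrow> (\<exists>s\<in>lead_pps \<sigma> S. s adds t)"
proof
  let ?M = "(\<lambda>g. Poly_Mapping.single (lead_pp \<sigma> g) 1 :: ('n, 'k) mpoly) ` (S - {0})"
  let ?T = "{h :: ('n, 'k) mpoly. \<forall>t\<in>Poly_Mapping.keys h. \<exists>s\<in>lead_pps \<sigma> S. s adds t}"
  interpret ring "P_ring :: ('n, 'k) mpoly ring" by (rule ring_P_ring)
  have "ideal ?T P_ring"
  proof (rule ideal_P_ringI)
    fix a b :: "('n, 'k) mpoly" assume "a \<in> ?T" "b \<in> ?T"
    then show "a + b \<in> ?T" using keys_add[of a b] by blast
  next
    fix a x :: "('n, 'k) mpoly" assume "a \<in> ?T"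
    then have "\<exists>s\<in>lead_pps \<sigma> S. s adds t" if "t \<in> Poly_Mapping.keys (x * a)" for t
      using that keys_mult[of x a] by (blast intro: adds_add)
    then show "x * a \<in> ?T" by blast
  qed auto
  moreover have "?M \<subseteq> ?T" using adds_refl by (fastforce simp: lead_pps_def)
  ultimately have "LT_ideal \<sigma> S \<subseteq> ?T" unfolding LT_ideal_def by (rule genideal_minimal)
  then show "\<exists>s\<in>lead_pps \<sigma> S. s adds t" if "Poly_Mapping.single t 1 \<in> LT_ideal \<sigma> S"
    using that by auto
  show "Poly_Mapping.single t 1 \<in> LT_ideal \<sigma> S" if st: "\<exists>s\<in>lead_pps \<sigma> S. s adds t"
  proof -
    obtain g u where g: "g \<in> S - {0}" "t = u + lead_pp \<sigma> g"
      using st by (auto simp: lead_pps_def adds_def add.commute)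
    interpret I: mpoly_ideal "LT_ideal \<sigma> S"
      unfolding LT_ideal_def by (rule mpoly_ideal.intro, rule genideal_ideal) simp
    have "Poly_Mapping.single (lead_pp \<sigma> g) 1 \<in> LT_ideal \<sigma> S"
      unfolding LT_ideal_def using genideal_self[of ?M] g(1) by auto
    from I.mult_mem[OF this, of "Poly_Mapping.single u 1"] show ?thesis
      by (simp add: g(2) mult_single)
  qed
qed

lemma LT_ideal_eqI:
  fixes S T :: "('n, 'k::field) mpoly set"
  assumes "S \<subseteq> T" "\<And>t. t \<in> lead_pps \<sigma> T \<Longrightarrow> \<exists>s\<in>lead_pps \<sigma> S. s adds t"
  shows "LT_ideal \<sigma> S = LT_ideal \<sigma> T"
proof
  interpret ring "P_ring :: ('n, 'k) mpoly ring" by (rule ring_P_ring)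
  show "LT_ideal \<sigma> S \<subseteq> LT_ideal \<sigma> T"
    unfolding LT_ideal_def
    by (rule genideal_minimal[OF genideal_ideal]) (use assms(1) genideal_self[of "(\<lambda>g. Poly_Mapping.single (lead_pp \<sigma> g) 1 :: ('n, 'k) mpoly) ` (T - {0})"] in auto)
  have "(\<lambda>g. Poly_Mapping.single (lead_pp \<sigma> g) 1) ` (T - {0}) \<subseteq> LT_ideal \<sigma> S"
    using assms(2) unfolding image_subset_iff single_in_LT_ideal_iff by (simp add: lead_pps_def)
  moreover have "ideal (LT_ideal \<sigma> S) P_ring"
    unfolding LT_ideal_def by (rule genideal_ideal) simp
  ultimately show "LT_ideal \<sigma> T \<subseteq> LT_ideal \<sigma> S"
    unfolding LT_ideal_def[of \<sigma> T] by (intro genideal_minimal)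
qed

locale ordered_ideal = pp_order \<sigma> + mpoly_ideal I
  for \<sigma> :: "'n::finite pp rel" and I :: "('n, 'k::field) mpoly set"
begin

definition standard_pps :: "'n pp set"
  where "standard_pps = - lead_pps \<sigma> I"

lemma lead_pps_adds:
  assumes "s \<in> lead_pps \<sigma> I" "s adds t"
  shows "t \<in> lead_pps \<sigma> I"
proof -
  obtain g u where g: "g \<in> I" "g \<noteq> 0" "t = u + lead_pp \<sigma> g"
    using assms by (auto simp: lead_pps_def adds_def add.commute)
  then have "t = lead_pp \<sigma> (Poly_Mapping.single u 1 * g)" "Poly_Mapping.single u 1 * g \<in> I - {0}"
    using lead_pp_single_mult[OF g(2), of 1 u] mult_mem[OF g(1), of "Poly_Mapping.single u 1"] by auto
  then show ?thesis unfolding lead_pps_def by blast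
qed

text \<open>Otherwise the leading power-product would be both standard and leading. This gives uniqueness of
normal forms and linear independence of the standard power-products modulo the ideal.\<close>

lemma standard_in_ideal_imp_zero:
  assumes "h \<in> I" "Poly_Mapping.keys h \<subseteq> standard_pps"
  shows "h = 0"
  using lead_pp_in_keys[of h] assms by (auto simp: standard_pps_def lead_pps_def)

lemma ex_remainder:
  obtains r where "h - r \<in> I" "Poly_Mapping.keys r \<subseteq> standard_pps"
proof -
  \<comment> \<open>Division by all monic elements of the ideal, since the finite basis is yet to be built.\<close>
  let ?G = "{g \<in> I. Poly_Mapping.lookup g (lead_pp \<sigma> g) = 1}"
  have G: "0 \<notin> ?G" "\<And>g. g \<in> ?G \<Longrightarrow> Poly_Mapping.lookup g (lead_pp \<sigma> g) = 1"
    "?G \<subseteq> full.mpolys_over" "h \<in> full.mpolys_over"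
    by (simp_all add: full.mpolys_over_def)
  obtain r where r: "h - r \<in> full.combinations ?G"
    "\<And>t g. t \<in> Poly_Mapping.keys r \<Longrightarrow> g \<in> ?G \<Longrightarrow> \<not> lead_pp \<sigma> g adds t"
    by (rule division[OF full.coeff_ring_axioms G]) (assumption, rule that)
  have "t \<in> standard_pps" if t: "t \<in> Poly_Mapping.keys r" for t
  proof (rule ccontr)
    assume "t \<notin> standard_pps"
    then obtain g where g: "g \<in> I" "g \<noteq> 0" "t = lead_pp \<sigma> g"
      by (auto simp: standard_pps_def lead_pps_def)
    define c where "c = inverse (Poly_Mapping.lookup g t)"
    have c: "c \<noteq> 0" "c * Poly_Mapping.lookup g t = 1"
      using lead_pp_in_keys[OF g(2)] by (simp_all add: c_def g(3) in_keys_iff)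
    let ?g = "Poly_Mapping.single 0 c * g"
    have lp: "lead_pp \<sigma> ?g = t" using lead_pp_single_mult(1)[OF g(2) c(1), of 0] g(3) by simp
    have "Poly_Mapping.lookup ?g t = 1"
      using lookup_single_mult[of 0 c g t] c(2) by simp
    with lp have "?g \<in> ?G" using mult_mem[OF g(1)] by simp
    from r(2)[OF t this] lp show False by (simp add: adds_refl)
  qed
  moreover have "h - r \<in> I"
    using full.combinations_subset_ideal[OF ideal_J _ r(1)] by auto
  ultimately show thesis using that by blast
qed

text \<open>The minimal generators of the leading term ideal; the reduced Groebner basis has one element for
each of them.\<close>

definition corner_pps :: "'n pp set"
  where "corner_pps = {t \<in> lead_pps \<sigma> I. \<forall>s\<in>lead_pps \<sigma> I. s adds t \<longrightarrow> s = t}"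

definition corner_basis :: "('n, 'k) mpoly set"
  where "corner_basis = {g \<in> I. \<exists>t\<in>corner_pps. Poly_Mapping.lookup g t = 1 \<and>
    Poly_Mapping.keys g \<subseteq> insert t standard_pps}"

lemma ex_corner_adds:
  assumes "t \<in> lead_pps \<sigma> I"
  obtains s where "s \<in> corner_pps" "s adds t"
proof -
  have "\<exists>s\<in>corner_pps. s adds t"
    using wf_\<sigma> assms
  proof (induction t)
    case (less t)
    show ?case
    proof (cases "t \<in> corner_pps")
      case False
      then obtain s where "s \<in> lead_pps \<sigma> I" "s adds t" "s \<noteq> t"
        using less.prems by (auto simp: corner_pps_def)
      with less.IH[of s] show ?thesis using adds_imp_\<sigma> adds_trans by blast
    qed (use adds_refl in blast)
  qed
  then show thesis using that by blast
qed

lemma lead_pp_corner: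
  assumes "g \<in> I" "t \<in> lead_pps \<sigma> I" "Poly_Mapping.lookup g t = 1" "Poly_Mapping.keys g \<subseteq> insert t standard_pps"
  shows "lead_pp \<sigma> g = t"
proof -
  have "g \<noteq> 0" using assms(3) by auto
  then have "lead_pp \<sigma> g \<in> Poly_Mapping.keys g" "lead_pp \<sigma> g \<in> lead_pps \<sigma> I"
    using assms(1) lead_pp_in_keys by (auto simp: lead_pps_def)
  with assms(4) show ?thesis by (auto simp: standard_pps_def)
qed

lemma corner_basis_memD:
  assumes "g \<in> corner_basis"
  shows "g \<in> I" "g \<noteq> 0" "Poly_Mapping.lookup g (lead_pp \<sigma> g) = 1" "lead_pp \<sigma> g \<in> corner_pps"
    "Poly_Mapping.keys g \<subseteq> insert (lead_pp \<sigma> g) standard_pps"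
proof -
  obtain t where t: "g \<in> I" "t \<in> corner_pps" "Poly_Mapping.lookup g t = 1"
    "Poly_Mapping.keys g \<subseteq> insert t standard_pps"
    using assms by (auto simp: corner_basis_def)
  moreover from this have "lead_pp \<sigma> g = t" by (intro lead_pp_corner) (auto simp: corner_pps_def)
  ultimately show "g \<in> I" "g \<noteq> 0" "Poly_Mapping.lookup g (lead_pp \<sigma> g) = 1"
    "lead_pp \<sigma> g \<in> corner_pps" "Poly_Mapping.keys g \<subseteq> insert (lead_pp \<sigma> g) standard_pps"
    by auto
qed

lemma corner_basis_unique:
  assumes "g \<in> I" "h \<in> I" "Poly_Mapping.lookup g t = 1" "Poly_Mapping.lookup h t = 1"
    "Poly_Mapping.keys g \<subseteq> insert t standard_pps" "Poly_Mapping.keys h \<subseteq> insert t standard_pps"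
  shows "g = h"
proof -
  have "s \<in> standard_pps" if "s \<in> Poly_Mapping.keys (g - h)" for s
  proof -
    have "s \<in> Poly_Mapping.keys g \<or> s \<in> Poly_Mapping.keys h" "s \<noteq> t"
      using assms(3,4) that by (auto simp: in_keys_iff lookup_minus)
    with assms(5,6) show ?thesis by auto
  qed
  then have "g - h = 0"
    using minus_mem[OF assms(1,2)] by (intro standard_in_ideal_imp_zero) auto
  then show ?thesis by simp
qed

lemma ex_corner_basis:
  assumes "t \<in> corner_pps"
  obtains g where "g \<in> corner_basis" "lead_pp \<sigma> g = t"
proof -
  obtain r where r: "Poly_Mapping.single t 1 - r \<in> I" "Poly_Mapping.keys r \<subseteq> standard_pps"
    by (rule ex_remainder)
  let ?g = "Poly_Mapping.single t 1 - r"
  have t: "t \<in> lead_pps \<sigma> I" using assms by (simp add: corner_pps_def)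
  then have "t \<notin> Poly_Mapping.keys r" using r(2) by (auto simp: standard_pps_def)
  then have l: "Poly_Mapping.lookup ?g t = 1" by (simp add: lookup_minus in_keys_iff)
  have "Poly_Mapping.keys ?g \<subseteq> insert t standard_pps"
    using r(2) by (auto simp: in_keys_iff lookup_minus lookup_single when_def split: if_splits)
  with l r(1) assms t show thesis
    by (intro that[of ?g] lead_pp_corner) (auto simp: corner_basis_def)
qed

text \<open>Distinct minimal generators do not divide each other, and antichains are finite by Dickson's
lemma.\<close>

lemma finite_corner_basis: "finite corner_basis"
proof -
  have "finite corner_pps"
    by (rule finite_adds_antichain) (auto simp: corner_pps_def)
  moreover have "inj_on (lead_pp \<sigma>) corner_basis"
  proof (rule inj_onI)
    fix g h assume gh: "g \<in> corner_basis" "h \<in> corner_basis" "lead_pp \<sigma> g = lead_pp \<sigma> h"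
    show "g = h"
      using corner_basis_memD[OF gh(1)] corner_basis_memD[OF gh(2)] gh(3)
      by (intro corner_basis_unique[of g h "lead_pp \<sigma> g"]) auto
  qed
  moreover have "lead_pp \<sigma> ` corner_basis \<subseteq> corner_pps" using corner_basis_memD(4) by blast
  ultimately show ?thesis by (meson finite_imageD finite_subset)
qed

lemma is_reduced_gb_corner_basis: "is_reduced_gb \<sigma> I corner_basis"
proof -
  have "\<exists>s\<in>lead_pps \<sigma> corner_basis. s adds t" if t: "t \<in> lead_pps \<sigma> I" for t
  proof -
    obtain s where s: "s \<in> corner_pps" "s adds t" using t by (rule ex_corner_adds)
    obtain g where "g \<in> corner_basis" "lead_pp \<sigma> g = s" using s(1) by (rule ex_corner_basis)
    with s(2) corner_basis_memD(2)[of g] show ?thesis by (auto simp: lead_pps_def)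
  qed
  then have "LT_ideal \<sigma> corner_basis = LT_ideal \<sigma> I"
    using corner_basis_memD(1) by (intro LT_ideal_eqI) blast+
  then have "groebner_basis \<sigma> I corner_basis"
    unfolding groebner_basis_def using finite_corner_basis corner_basis_memD(1,2) by auto
  moreover have "Poly_Mapping.single t 1 \<notin> LT_ideal \<sigma> (corner_basis - {g})"
    if g: "g \<in> corner_basis" and t: "t \<in> Poly_Mapping.keys g" for g t
  proof
    assume "Poly_Mapping.single t 1 \<in> LT_ideal \<sigma> (corner_basis - {g})"
    then obtain h where h: "h \<in> corner_basis" "h \<noteq> g" "lead_pp \<sigma> h adds t"
      by (auto simp: single_in_LT_ideal_iff lead_pps_def)
    note gD = corner_basis_memD[OF g] and hD = corner_basis_memD[OF h(1)]
    have hl: "lead_pp \<sigma> h \<in> lead_pps \<sigma> I" using hD(4) by (simp add: corner_pps_def)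
    then have "t \<in> lead_pps \<sigma> I" using h(3) lead_pps_adds by blast
    then have "t = lead_pp \<sigma> g" using t gD(5) by (auto simp: standard_pps_def)
    then have "lead_pp \<sigma> h = lead_pp \<sigma> g"
      using gD(4) h(3) hl by (simp add: corner_pps_def)
    then have "h = g" using gD hD by (intro corner_basis_unique[of h g "lead_pp \<sigma> g"]) auto
    with h(2) show False by simp
  qed
  ultimately show ?thesis
    unfolding is_reduced_gb_def using corner_basis_memD(3) by blast
qed

text \<open>In a reduced basis only \<open>h\<close> itself can divide one of the power-products of \<open>h\<close> by its
leading power-product. Hence \<open>lead_pp \<sigma> h\<close> is a minimal generator and the other
power-products of \<open>h\<close> are standard, which determines \<open>h\<close>.\<close>

lemma is_reduced_gb_imp_corner_basis:
  assumes "is_reduced_gb \<sigma> I H"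
  shows "H = corner_basis"
proof -
  have H: "0 \<notin> H" "H \<subseteq> I" "LT_ideal \<sigma> H = LT_ideal \<sigma> I"
    and monic: "\<And>h. h \<in> H \<Longrightarrow> Poly_Mapping.lookup h (lead_pp \<sigma> h) = 1"
    and red: "\<And>h t. h \<in> H \<Longrightarrow> t \<in> Poly_Mapping.keys h \<Longrightarrow> Poly_Mapping.single t 1 \<notin> LT_ideal \<sigma> (H - {h})"
    using assms by (auto simp: is_reduced_gb_def groebner_basis_def)
  have ex: "\<exists>h\<in>H. lead_pp \<sigma> h adds t" if "t \<in> lead_pps \<sigma> I" for t
  proof -
    have "Poly_Mapping.single t 1 \<in> LT_ideal \<sigma> H"
      unfolding H(3) using that adds_refl by (auto simp: single_in_LT_ideal_iff)
    then show ?thesis by (auto simp: single_in_LT_ideal_iff lead_pps_def)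
  qed
  have own: "h' = h" if "h \<in> H" "h' \<in> H" "t \<in> Poly_Mapping.keys h" "lead_pp \<sigma> h' adds t" for h h' t
    using red[OF that(1,3)] that(2,4) H(1) by (auto simp: single_in_LT_ideal_iff lead_pps_def)
  have nz: "h \<noteq> 0" if "h \<in> H" for h using that H(1) by auto
  have lpI: "lead_pp \<sigma> h \<in> lead_pps \<sigma> I" if "h \<in> H" for h
    using that H(2) nz by (auto simp: lead_pps_def)
  have sub: "h \<in> corner_basis \<and> lead_pp \<sigma> h \<in> corner_pps" if h: "h \<in> H" for h
  proof -
    have "s = lead_pp \<sigma> h" if s: "s \<in> lead_pps \<sigma> I" "s adds lead_pp \<sigma> h" for s
    proof -
      obtain h' where h': "h' \<in> H" "lead_pp \<sigma> h' adds s" using ex[OF s(1)] by blast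
      then have "h' = h" using own[OF h _ lead_pp_in_keys[OF nz[OF h]]] s(2) adds_trans by blast
      with h'(2) s(2) show ?thesis using adds_antisym by blast
    qed
    then have c: "lead_pp \<sigma> h \<in> corner_pps" using lpI[OF h] by (simp add: corner_pps_def)
    have "t = lead_pp \<sigma> h" if t: "t \<in> Poly_Mapping.keys h" "t \<in> lead_pps \<sigma> I" for t
    proof -
      obtain h' where h': "h' \<in> H" "lead_pp \<sigma> h' adds t" using ex[OF t(2)] by blast
      then have "h' = h" using own[OF h _ t(1)] by blast
      with h'(2) have "(lead_pp \<sigma> h, t) \<in> \<sigma>" by (auto intro: adds_imp_\<sigma>)
      with keys_le_lead_pp[OF nz[OF h] t(1)] show ?thesis by (rule antisym_\<sigma>)
    qed
    then have "Poly_Mapping.keys h \<subseteq> insert (lead_pp \<sigma> h) standard_pps"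
      by (auto simp: standard_pps_def)
    with c monic[OF h] h H(2) show ?thesis by (auto simp: corner_basis_def)
  qed
  have "g \<in> H" if g: "g \<in> corner_basis" for g
  proof -
    note gD = corner_basis_memD[OF g]
    obtain h where h: "h \<in> H" "lead_pp \<sigma> h adds lead_pp \<sigma> g"
      using ex[of "lead_pp \<sigma> g"] gD(4) by (auto simp: corner_pps_def)
    then have "lead_pp \<sigma> h = lead_pp \<sigma> g" using gD(4) lpI[OF h(1)] by (simp add: corner_pps_def)
    moreover note hD = corner_basis_memD[OF conjunct1[OF sub[OF h(1)]]]
    ultimately have "h = g" using gD hD by (intro corner_basis_unique[of h g "lead_pp \<sigma> g"]) auto
    with h(1) show ?thesis by simp
  qed
  with sub show ?thesis by blast
qed

lemma reduced_gb_eq: "reduced_gb \<sigma> I = corner_basis"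
  unfolding reduced_gb_def
  using is_reduced_gb_corner_basis is_reduced_gb_imp_corner_basis by (rule the_equality)

text \<open>Normal forms of polynomials over \<open>R\<close> are again over \<open>R\<close> when the reduced basis is.
This is the point of inverting only the denominators of the basis.\<close>

lemma division_by_reduced_gb:
  assumes "coeff_ring R" "reduced_gb \<sigma> I \<subseteq> coeff_ring.mpolys_over R" "h \<in> coeff_ring.mpolys_over R"
  obtains r where "r \<in> coeff_ring.mpolys_over R" "Poly_Mapping.keys r \<subseteq> standard_pps"
    "h - r \<in> coeff_ring.combinations R (reduced_gb \<sigma> I)" "h - r \<in> I"
proof -
  interpret coeff_ring R by fact
  obtain r where r: "r \<in> mpolys_over" "h - r \<in> combinations (reduced_gb \<sigma> I)"
    "\<And>t g. t \<in> Poly_Mapping.keys r \<Longrightarrow> g \<in> corner_basis \<Longrightarrow> \<not> lead_pp \<sigma> g adds t"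
    using division[OF assms(1), of corner_basis h] assms(2,3) corner_basis_memD(2,3)
    unfolding reduced_gb_eq by blast
  have "t \<in> standard_pps" if t: "t \<in> Poly_Mapping.keys r" for t
  proof (rule ccontr)
    assume "t \<notin> standard_pps"
    then have "t \<in> lead_pps \<sigma> I" by (simp add: standard_pps_def)
    then obtain s where s: "s \<in> corner_pps" "s adds t" by (rule ex_corner_adds)
    obtain g where "g \<in> corner_basis" "lead_pp \<sigma> g = s" using s(1) by (rule ex_corner_basis)
    with r(3)[OF t] s(2) show False by blast
  qed
  moreover have "h - r \<in> I"
    using combinations_subset_ideal[OF ideal_J _ r(2)] corner_basis_memD(1)
    unfolding reduced_gb_eq by blast
  ultimately show thesis using that r(1,2) by blast
qed

end

section \<open>Minimal polynomials\<close>

interpretation const_mpoly: comm_ring_hom "const_mpoly :: 'k::field \<Rightarrow> ('n, 'k) mpoly"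
  by unfold_locales (simp_all add: const_mpoly_def single_add mult_single)

text \<open>The substitution \<open>z \<mapsto> g\<close>; composed with the residue map it is \<open>eval_mod\<close>.\<close>

definition eval_at :: "('n, 'k::field) mpoly \<Rightarrow> 'k poly \<Rightarrow> ('n, 'k) mpoly"
  where "eval_at g q = poly (map_poly const_mpoly q) g"

lemma eval_at_pCons: "eval_at g (pCons a q) = const_mpoly a + g * eval_at g q"
  by (simp add: eval_at_def const_mpoly.map_poly_pCons_hom)

interpretation eval_at: comm_ring_hom "eval_at g" for g :: "('n, 'k::field) mpoly"
proof -
  interpret m: map_poly_comm_ring_hom "const_mpoly :: 'k \<Rightarrow> ('n, 'k) mpoly" ..
  show "comm_ring_hom (eval_at g)"
    by unfold_locales (simp_all add: eval_at_def m.hom_add m.hom_mult)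
qed

context mpoly_ideal
begin

lemma minimal_poly_kernel:
  "a_kernel Kz_ring (P_ring Quot J) (eval_mod g J) = {q. eval_at g q \<in> J}"
  by (simp add: a_kernel_def' eval_mod_def eval_at_def residue_class_eq_zero_iff)

lemma genideal_Kz_ring: "genideal Kz_ring {m :: 'k poly} = {q. m dvd q}"
proof -
  interpret cring "Kz_ring :: 'k poly ring" by (rule cring_Kz_ring)
  show ?thesis
    using cgenideal_eq_genideal[of m]
    by (auto simp: cgenideal_def dvd_def mult.commute)
qed

text \<open>The kernel of \<open>q \<mapsto> q(g) mod J\<close> is an ideal of a Euclidean ring, generated by an element
of least degree. A monic generator exists as soon as the kernel contains a non-zero element \<open>q0\<close>.
For the rational ideal \<open>q0\<close> will be an integral equation of \<open>g\<close>; modulo \<open>p\<close> it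
will be the reduction of the rational minimal polynomial.\<close>

lemma minimal_poly:
  assumes "q0 \<noteq> 0" "eval_at g q0 \<in> J"
  shows lead_coeff_minimal_poly: "lead_coeff (minimal_poly g J) = 1"
    and minimal_poly_dvd_iff: "minimal_poly g J dvd q \<longleftrightarrow> eval_at g q \<in> J"
proof -
  define d where "d = (LEAST d. \<exists>q. q \<noteq> 0 \<and> eval_at g q \<in> J \<and> degree q = d)"
  have "\<exists>q. q \<noteq> 0 \<and> eval_at g q \<in> J \<and> degree q = d"
    unfolding d_def by (rule LeastI_ex) (use assms in blast)
  then obtain q1 where q1: "q1 \<noteq> 0" "eval_at g q1 \<in> J" "degree q1 = d" by blast
  have least: "d \<le> degree q" if "q \<noteq> 0" "eval_at g q \<in> J" for q
    unfolding d_def by (rule Least_le) (use that in blast)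
  define m where "m = smult (inverse (lead_coeff q1)) q1"
  have m: "lead_coeff m = 1" "degree m = d"
    using q1 leading_coeff_neq_0[OF q1(1)] by (simp_all add: m_def)
  have "m = [:inverse (lead_coeff q1):] * q1" by (simp add: m_def)
  then have mJ: "eval_at g m \<in> J" using q1(2) by (simp only: eval_at.hom_mult mult_mem)
  have dvd: "m dvd q \<longleftrightarrow> eval_at g q \<in> J" for q
  proof
    assume "m dvd q"
    then show "eval_at g q \<in> J"
      using mJ by (auto simp: dvd_def eval_at.hom_mult mult.commute[of "eval_at g m"] mult_mem)
  next
    assume q: "eval_at g q \<in> J"
    have "q mod m = q - (q div m) * m" by (simp add: minus_div_mult_eq_mod)
    then have "eval_at g (q mod m) \<in> J"
      using q mJ by (simp add: eval_at.hom_minus eval_at.hom_mult minus_mem mult_mem)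
    moreover have "q mod m = 0 \<or> degree (q mod m) < d"
      using degree_mod_less[of m q] m by force
    ultimately have "q mod m = 0" using least[of "q mod m"] by fastforce
    then show "m dvd q" by (rule dvd_eq_mod_eq_0[THEN iffD2])
  qed
  have "minimal_poly g J = m"
    unfolding minimal_poly_def minimal_poly_kernel genideal_Kz_ring
  proof (rule the_equality)
    show "lead_coeff m = 1 \<and> {q. m dvd q} = {q. eval_at g q \<in> J}" using m dvd by auto
  next
    fix m' assume m': "lead_coeff m' = 1 \<and> {q. m' dvd q} = {q. eval_at g q \<in> J}"
    then have "\<And>q. m' dvd q \<longleftrightarrow> m dvd q" using dvd by blast
    then have "m' dvd m" "m dvd m'" using dvd_refl by blast+
    then show "m' = m" using m' m(1) by (intro poly_dvd_antisym) auto
  qed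
  with m(1) dvd show "lead_coeff (minimal_poly g J) = 1"
    "minimal_poly g J dvd q \<longleftrightarrow> eval_at g q \<in> J" by auto
qed

end


section \<open>Linear independence modulo an ideal\<close>

context mpoly_ideal
begin

text \<open>Linear independence of the residue classes of \<open>gs\<close>, expressed by representatives and
coefficients in the base field instead of the copy of that field inside the quotient ring.\<close>

definition independent_mod :: "('n, 'k) mpoly list \<Rightarrow> bool"
  where "independent_mod gs \<longleftrightarrow>
    (\<forall>c. (\<Sum>i<length gs. const_mpoly (c i) * gs ! i) \<in> J \<longrightarrow> (\<forall>i<length gs. c i = 0))"

lemma residue_class_hom: "residue_class J \<in> Ring.ring_hom P_ring (P_ring Quot J)"
  using ideal.rcos_ring_hom[OF ideal_J] by (simp add: residue_class_def[abs_def])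

lemma ring_Quot: "ring (P_ring Quot J)"
  by (rule ideal.quotient_is_ring[OF ideal_J])

lemma residue_class_add: "residue_class J a \<oplus>\<^bsub>P_ring Quot J\<^esub> residue_class J b = residue_class J (a + b)"
  and residue_class_mult: "residue_class J a \<otimes>\<^bsub>P_ring Quot J\<^esub> residue_class J b = residue_class J (a * b)"
  and residue_class_carrier: "residue_class J a \<in> carrier (P_ring Quot J)"
  and residue_class_zero: "\<zero>\<^bsub>P_ring Quot J\<^esub> = residue_class J 0"
  and residue_class_one: "\<one>\<^bsub>P_ring Quot J\<^esub> = residue_class J 1"
  using ring_hom_add[OF residue_class_hom, of a b] ring_hom_mult[OF residue_class_hom, of a b]
    ring_hom_closed[OF residue_class_hom, of a] ring_hom_one[OF residue_class_hom]
    residue_class_eq_zero_iff[of 0] zero_mem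
  by simp_all

lemma carrier_Quot: "carrier (P_ring Quot J) = range (residue_class J)"
  by (auto simp: FactRing_def A_RCOSETS_def' residue_class_def)

lemma zero_dimensional_imp_proper: "zero_dimensional J \<Longrightarrow> 1 \<notin> J"
proof
  assume "zero_dimensional J" and one: "1 \<in> J"
  have "residue_class J x = \<zero>\<^bsub>P_ring Quot J\<^esub>" for x
    using mult_mem[OF one, of x] by (simp add: residue_class_eq_zero_iff)
  then have "carrier (P_ring Quot J) = {\<zero>\<^bsub>P_ring Quot J\<^esub>}"
    unfolding carrier_Quot by auto
  with \<open>zero_dimensional J\<close> show False by (simp add: zero_dimensional_def)
qed

lemma subfield_scalars_mod:
  assumes "1 \<notin> J"
  shows "subfield (scalars_mod J) (P_ring Quot J)"
proof -
  let ?K = "ring_of_type_algebra :: 'k ring"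
  let ?h = "\<lambda>c. residue_class J (const_mpoly c)"
  interpret K: field ?K by (rule field_from_type_algebra)
  interpret Q: ring "P_ring Quot J" by (rule ring_Quot)
  have "?h \<in> Ring.ring_hom ?K (P_ring Quot J)"
    by (rule ring_hom_memI)
       (simp_all add: residue_class_carrier residue_class_add
          residue_class_mult residue_class_one const_mpoly.hom_add const_mpoly.hom_mult)
  then interpret h: ring_hom_ring ?K "P_ring Quot J" ?h
    by (rule ring_hom_ringI2[OF K.ring_axioms Q.ring_axioms])
  have "subfield (?h ` carrier ?K) (P_ring Quot J)"
    using assms residue_class_eq_zero_iff[of 1]
    by (intro h.img_is_subfield(2) K.carrier_is_subfield) (simp add: residue_class_one)
  then show ?thesis by (simp add: scalars_mod_def)
qed

lemma independent_residue_classes: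
  assumes "1 \<notin> J" "independent_mod gs"
  shows "ring.independent (P_ring Quot J) (scalars_mod J) (map (residue_class J) gs)"
proof (rule ccontr)
  interpret Q: ring "P_ring Quot J" by (rule ring_Quot)
  note sub = subfield_scalars_mod[OF assms(1)]
  let ?Us = "map (residue_class J) gs"
  assume dep: "\<not> Q.independent (scalars_mod J) ?Us"
  have "set ?Us \<subseteq> carrier (P_ring Quot J)" by (auto simp: residue_class_carrier)
  from Q.dependent_imp_non_trivial_combine[OF sub this dep]
  obtain Ks where Ks: "length Ks = length gs" "Q.combine Ks ?Us = \<zero>\<^bsub>P_ring Quot J\<^esub>"
    "set Ks \<subseteq> scalars_mod J" "set Ks \<noteq> {\<zero>\<^bsub>P_ring Quot J\<^esub>}"
    by auto
  have "\<exists>cs. Ks = map (\<lambda>c. residue_class J (const_mpoly c)) cs"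
    using Ks(3) unfolding ex_map_conv scalars_mod_def by blast
  then obtain cs where cs: "Ks = map (\<lambda>c. residue_class J (const_mpoly c)) cs" by blast
  have comb: "Q.combine (map (\<lambda>c. residue_class J (const_mpoly c)) cs) (map (residue_class J) gs)
      = residue_class J (\<Sum>i<length gs. const_mpoly (cs ! i) * gs ! i)"
    if "length cs = length gs" for cs gs
    using that
    by (induction cs gs rule: list_induct2)
       (simp_all add: residue_class_zero residue_class_add residue_class_mult
          sum.lessThan_Suc_shift del: sum.lessThan_Suc)
  have len: "length cs = length gs" using Ks(1) cs by simp
  have "(\<Sum>i<length gs. const_mpoly (cs ! i) * gs ! i) \<in> J"
    using Ks(2) comb[OF len] by (simp add: cs residue_class_eq_zero_iff)
  then have "\<forall>i<length gs. cs ! i = 0" using assms(2) unfolding independent_mod_def by blast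
  then have "set cs \<subseteq> {0}" using len by (auto simp: in_set_conv_nth)
  then have "set Ks \<subseteq> {\<zero>\<^bsub>P_ring Quot J\<^esub>}"
    by (auto simp: cs residue_class_zero)
  moreover have "Ks \<noteq> []" using dep Ks(1) by auto
  ultimately show False using Ks(4) by (auto simp: subset_singleton_iff)
qed

lemma independent_mod_length_le_quot_dim:
  assumes "zero_dimensional J" "independent_mod gs"
  shows "length gs \<le> quot_dim J"
proof -
  interpret Q: ring "P_ring Quot J" by (rule ring_Quot)
  note proper = zero_dimensional_imp_proper[OF assms(1)]
  note sub = subfield_scalars_mod[OF proper]
  have "Q.dimension (quot_dim J) (scalars_mod J) (carrier (P_ring Quot J))"
    using Q.finite_dimensionE[OF sub] assms(1)
    by (simp add: zero_dimensional_def quot_dim_def over_def)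
  moreover have "set (map (residue_class J) gs) \<subseteq> carrier (P_ring Quot J)"
    by (auto simp: residue_class_carrier)
  ultimately have "length (map (residue_class J) gs) \<le> quot_dim J"
    using Q.independent_length_le_dimension[OF sub] independent_residue_classes[OF proper assms(2)]
    by blast
  then show ?thesis by simp
qed

text \<open>The powers of \<open>g\<close> below the degree of its minimal polynomial are independent: a relation between
them would be a multiple of the minimal polynomial of smaller degree.\<close>

lemma degree_minimal_poly_le_quot_dim:
  assumes "zero_dimensional J" "q0 \<noteq> 0" "eval_at g q0 \<in> J"
  shows "degree (minimal_poly g J) \<le> quot_dim J"
proof -
  let ?d = "degree (minimal_poly g J)"
  let ?gs = "map (\<lambda>i. g ^ i) [0..<?d]"
  have "c i = 0" if c: "(\<Sum>i<?d. const_mpoly (c i) * g ^ i) \<in> J" and i: "i < ?d" for c i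
  proof -
    let ?q = "\<Sum>i<?d. monom (c i) i"
    have "eval_at g (monom a i) = const_mpoly a * g ^ i" for a i
      by (simp add: eval_at_def map_poly_monom poly_monom)
    then have "eval_at g ?q \<in> J" using c by (simp add: eval_at.hom_sum)
    then have dvd: "minimal_poly g J dvd ?q" using minimal_poly_dvd_iff[OF assms(2,3)] by blast
    have co: "coeff ?q j = (if j < ?d then c j else 0)" for j
      by (simp add: coeff_sum)
    have "?q = 0"
    proof (rule ccontr)
      assume nz: "?q \<noteq> 0"
      from dvd nz have "?d \<le> degree ?q" by (rule dvd_imp_degree_le)
      moreover have "lead_coeff ?q \<noteq> 0" using nz by simp
      ultimately show False unfolding co by simp
    qed
    with co[of i] i show "c i = 0" by simp
  qed
  then have "independent_mod ?gs" by (simp add: independent_mod_def)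
  from independent_mod_length_le_quot_dim[OF assms(1) this] show ?thesis by simp
qed

end

context ordered_ideal
begin

lemma finite_standard_pps:
  assumes "zero_dimensional I"
  shows "finite standard_pps"
proof -
  have "card B \<le> quot_dim I" if B: "B \<subseteq> standard_pps" "finite B" for B
  proof -
    obtain bs where bs: "set bs = B" "distinct bs" using finite_distinct_list[OF B(2)] by blast
    let ?gs = "map (\<lambda>b. Poly_Mapping.single b 1 :: ('n, 'k) mpoly) bs"
    have "c i = 0" if c: "(\<Sum>i<length bs. const_mpoly (c i) * Poly_Mapping.single (bs ! i) 1) \<in> I"
      and i: "i < length bs" for c i
    proof -
      let ?h = "\<Sum>i<length bs. Poly_Mapping.single (bs ! i) (c i)"
      have h: "(\<Sum>i<length bs. const_mpoly (c i) * Poly_Mapping.single (bs ! i) 1) = ?h"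
        by (simp add: const_mpoly_def mult_single)
      have "t \<in> standard_pps" if t: "t \<in> Poly_Mapping.keys ?h" for t
      proof (rule ccontr)
        assume "t \<notin> standard_pps"
        then have "bs ! j \<noteq> t" if "j < length bs" for j
          using B(1) bs(1) nth_mem[OF that] by auto
        then have "Poly_Mapping.lookup ?h t = 0"
          by (auto simp: lookup_sum lookup_single when_def intro!: sum.neutral)
        with t show False by (simp add: in_keys_iff)
      qed
      then have "?h = 0" using c h by (intro standard_in_ideal_imp_zero) auto
      moreover have "Poly_Mapping.lookup ?h (bs ! i) = (\<Sum>j<length bs. if j = i then c j else 0)"
        unfolding lookup_sum using bs(2) i
        by (intro sum.cong) (auto simp: lookup_single when_def nth_eq_iff_index_eq)
      ultimately show ?thesis using i by simp
    qed
    then have "independent_mod ?gs" by (simp add: independent_mod_def)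
    from independent_mod_length_le_quot_dim[OF assms this] show ?thesis
      using distinct_card[OF bs(2)] bs(1) by simp
  qed
  then show ?thesis using finite_if_finite_subsets_card_bdd by blast
qed

end


section \<open>Integral equations from determinants\<close>

text \<open>The determinant trick: multiply the system of congruences \<open>N b \<equiv> 0\<close> by the adjugate
of \<open>N\<close>.\<close>

lemma (in mpoly_ideal) det_mult_mem:
  assumes N: "N \<in> carrier_mat n n"
    and Nb: "\<And>i. i < n \<Longrightarrow> (\<Sum>j<n. N $$ (i, j) * b j) \<in> J"
    and k: "k < n"
  shows "det N * b k \<in> J"
proof -
  let ?A = "adj_mat N"
  have A: "?A \<in> carrier_mat n n" "?A * N = det N \<cdot>\<^sub>m 1\<^sub>m n" using adj_mat[OF N] by auto
  have entry: "(\<Sum>i<n. ?A $$ (k, i) * N $$ (i, j)) = (if j = k then det N else 0)" if "j < n" for j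
  proof -
    have "(\<Sum>i<n. ?A $$ (k, i) * N $$ (i, j)) = (?A * N) $$ (k, j)"
      using A(1) N k that by (auto simp: scalar_prod_def atLeast0LessThan)
    then show ?thesis using k that by (simp add: A(2))
  qed
  have "(\<Sum>i<n. ?A $$ (k, i) * (\<Sum>j<n. N $$ (i, j) * b j)) \<in> J"
    using Nb by (auto intro: sum_mem mult_mem)
  also have "(\<Sum>i<n. ?A $$ (k, i) * (\<Sum>j<n. N $$ (i, j) * b j))
      = (\<Sum>j<n. (\<Sum>i<n. ?A $$ (k, i) * N $$ (i, j)) * b j)"
    by (simp add: sum_distrib_left sum_distrib_right mult.assoc) (rule sum.swap)
  also have "\<dots> = (\<Sum>j<n. if j = k then det N * b j else 0)"
    using entry by (intro sum.cong) auto
  also have "\<dots> = det N * b k" using k by simp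
  finally show ?thesis .
qed

lemma (in coeff_ring) char_poly_over:
  assumes A: "A \<in> carrier_mat n n" "\<And>i j. i < n \<Longrightarrow> j < n \<Longrightarrow> A $$ (i, j) \<in> R"
  shows "char_poly A \<in> polys_over"
proof -
  have "[:0, 1:] \<in> polys_over"
    by (auto simp: polys_over_def coeff_pCons zero_R one_R split: nat.splits)
  then have "(if i = j then [:0, 1:] else 0) + [:- A $$ (i, j):] \<in> polys_over"
    if "i < n" "j < n" for i j
    using const_polys_over[OF uminus_R[OF A(2)[OF that]]] const_polys_over[OF zero_R]
    by (intro add_polys_over) auto
  moreover have "char_poly_matrix A $$ (i, j) = (if i = j then [:0, 1:] else 0) + [:- A $$ (i, j):]"
    if "i < n" "j < n" for i j
    using A(1) that by (simp add: char_poly_matrix_def)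
  ultimately have "char_poly_matrix A $$ (i, j) \<in> polys_over" if "i < n" "j < n" for i j
    using that by simp
  moreover have "(signof p :: 'k poly) \<in> polys_over" for p
    using const_polys_over[OF one_R] const_polys_over[OF uminus_R[OF one_R]]
    by (cases p rule: sign_cases) (auto simp: one_pCons)
  ultimately show ?thesis
    unfolding char_poly_def det_def'[OF char_poly_matrix_closed[OF A(1)]]
    by (auto intro!: sum_polys_over mult_polys_over prod_polys_over dest: permutes_in_image)
qed

context ordered_ideal
begin

text \<open>The standard power-products span the polynomials over \<open>R\<close> modulo the ideal, also with
coefficients in \<open>R\<close>, and there are finitely many of them. So multiplication by \<open>f\<close> has a
matrix over \<open>R\<close>, and its characteristic polynomial annihilates \<open>f\<close> by the determinant trick
applied to the standard power-product 1.\<close>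

lemma ex_integral_equation:
  assumes "coeff_ring R" "zero_dimensional I"
    and G: "reduced_gb \<sigma> I \<subseteq> coeff_ring.mpolys_over R"
    and f: "f \<in> coeff_ring.mpolys_over R"
  obtains h where "lead_coeff h = 1" "h \<in> coeff_ring.polys_over R" "eval_at f h \<in> I"
proof -
  interpret coeff_ring R by fact
  obtain bs where bs: "set bs = standard_pps" "distinct bs"
    using finite_distinct_list[OF finite_standard_pps[OF assms(2)]] by blast
  let ?n = "length bs"
  let ?b = "\<lambda>i. Poly_Mapping.single (bs ! i) 1 :: ('n, 'k) mpoly"
  have "\<exists>r. r \<in> mpolys_over \<and> Poly_Mapping.keys r \<subseteq> standard_pps \<and> f * ?b i - r \<in> I" for i
  proof -
    have "f * ?b i \<in> mpolys_over" using f one_R by (intro mult_over single_over)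
    from division_by_reduced_gb[OF assms(1) G this] show ?thesis by blast
  qed
  then obtain r where r: "\<And>i. r i \<in> mpolys_over" "\<And>i. Poly_Mapping.keys (r i) \<subseteq> standard_pps"
    "\<And>i. f * ?b i - r i \<in> I" by metis
  define A where "A = mat ?n ?n (\<lambda>(i, j). Poly_Mapping.lookup (r i) (bs ! j))"
  have A: "A \<in> carrier_mat ?n ?n" by (simp add: A_def)
  have r_sum: "r i = (\<Sum>j<?n. const_mpoly (A $$ (i, j)) * ?b j)" if i: "i < ?n" for i
  proof -
    have "r i = (\<Sum>t\<in>set bs. Poly_Mapping.single t (Poly_Mapping.lookup (r i) t))"
      unfolding bs(1) using r(2)[of i] finite_standard_pps[OF assms(2)]
      by (subst mpoly_eq_sum_single, intro sum.mono_neutral_left) (auto simp: in_keys_iff)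
    also have "\<dots> = (\<Sum>j<?n. Poly_Mapping.single (bs ! j) (Poly_Mapping.lookup (r i) (bs ! j)))"
      using sum.reindex_bij_betw[OF bij_betw_nth[OF bs(2) refl refl], symmetric] .
    also have "\<dots> = (\<Sum>j<?n. const_mpoly (A $$ (i, j)) * ?b j)"
      using i by (intro sum.cong) (auto simp: A_def const_mpoly_def mult_single)
    finally show ?thesis .
  qed
  let ?N = "map_mat (eval_at f) (char_poly_matrix A)"
  have N: "?N \<in> carrier_mat ?n ?n" using A by simp
  have "(\<Sum>j<?n. ?N $$ (i, j) * ?b j) \<in> I" if i: "i < ?n" for i
  proof -
    have "?N $$ (i, j) * ?b j = (if j = i then f * ?b j else 0) - const_mpoly (A $$ (i, j)) * ?b j"
      if j: "j < ?n" for j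
      using A i j by (auto simp: char_poly_matrix_def eval_at_pCons eval_at.hom_add
          const_mpoly.hom_uminus left_diff_distrib)
    then have "(\<Sum>j<?n. ?N $$ (i, j) * ?b j)
        = (\<Sum>j<?n. if j = i then f * ?b j else 0) - (\<Sum>j<?n. const_mpoly (A $$ (i, j)) * ?b j)"
      by (simp add: sum_subtractf)
    also have "\<dots> = f * ?b i - r i" using i r_sum[OF i] by simp
    finally show ?thesis using r(3) by simp
  qed
  then have det_mem: "det ?N * ?b k \<in> I" if "k < ?n" for k
    using that by (intro det_mult_mem[OF N]) auto
  \<comment> \<open>The ideal is proper, so 1 is standard and can be the entry picked from the vector.\<close>
  have "0 \<in> standard_pps"
  proof (rule ccontr)
    assume "0 \<notin> standard_pps"
    then have "0 \<in> lead_pp \<sigma> ` (I - {0})" by (simp add: standard_pps_def lead_pps_def)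
    then obtain g where "g \<in> I - {0}" "0 = lead_pp \<sigma> g" by (rule imageE)
    then have g: "g \<in> I" "g \<noteq> 0" "lead_pp \<sigma> g = 0" by simp_all
    have "Poly_Mapping.keys g = {0}"
      using keys_le_lead_pp[OF g(2)] lead_pp_in_keys[OF g(2)] g(3) antisym_\<sigma>[OF _ zero_\<sigma>] by auto
    then have "g = const_mpoly (Poly_Mapping.lookup g 0)" "Poly_Mapping.lookup g 0 \<noteq> 0"
      using mpoly_eq_sum_single[of g] by (auto simp: const_mpoly_def in_keys_iff)
    then have "const_mpoly (inverse (Poly_Mapping.lookup g 0)) * g = 1"
      by (metis const_mpoly.hom_mult const_mpoly.hom_one left_inverse)
    with mult_mem[OF g(1)] zero_dimensional_imp_proper[OF assms(2)] show False by metis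
  qed
  then obtain k where k: "k < ?n" "bs ! k = 0" using bs(1) by (metis in_set_conv_nth)
  have "eval_at f (char_poly A) \<in> I"
    using det_mem[OF k(1)] k(2) by (simp add: char_poly_def)
  moreover have "char_poly A \<in> polys_over"
    using A by (rule char_poly_over) (auto simp: A_def intro: mpolys_overD r(1))
  moreover have "lead_coeff (char_poly A) = 1"
    using degree_monic_char_poly[OF A] by simp
  ultimately show thesis using that by blast
qed

end

section \<open>Reduction modulo a prime\<close>

text \<open>The localization of the integers at \<open>p\<close>. It contains the fractions \<open>a/\<delta>^k\<close> for every
\<open>\<delta>\<close> prime to \<open>p\<close>, and \<open>rat_mod\<close> is a ring homomorphism on it.\<close>

definition local_rats :: "nat \<Rightarrow> rat set"
  where "local_rats p = {q. \<not> int p dvd rat_den q}"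

lemma local_ratE:
  assumes "q \<in> local_rats p"
  obtains a d where "q = of_int a / of_int d" "\<not> int p dvd d"
  using assms quotient_of_div[of q "fst (quotient_of q)" "snd (quotient_of q)"]
  unfolding local_rats_def rat_den_def by auto

lemma frac_in_local_rats:
  assumes "\<not> int p dvd d"
  shows "of_int a / of_int d \<in> local_rats p"
proof -
  obtain m n where mn: "quotient_of (of_int a / of_int d) = (m, n)" by fastforce
  have d: "d \<noteq> 0" using assms by auto
  have n: "n > 0" "coprime m n" "of_int a / of_int d = (of_int m / of_int n :: rat)"
    using mn quotient_of_denom_pos quotient_of_coprime quotient_of_div by blast+
  then have "of_int (a * n) = (of_int (m * d) :: rat)" using d by (simp add: field_simps)
  then have "a * n = m * d" by (simp only: of_int_eq_iff)
  then have "n dvd d"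
    using n(2) by (metis coprime_commute coprime_dvd_mult_right_iff dvd_triv_right)
  with assms show ?thesis by (auto simp: local_rats_def rat_den_def mn)
qed

lemma int_in_local_rats: "1 < p \<Longrightarrow> of_int a \<in> local_rats p"
  using frac_in_local_rats[of p 1 a] by simp

lemma coeff_ring_local_rats:
  assumes "prime p"
  shows "coeff_ring (local_rats p)"
proof
  have p: "prime (int p)" using assms by simp
  show "1 \<in> local_rats p"
    using int_in_local_rats[of p 1] prime_gt_1_nat[OF assms] by simp
  fix a b assume "a \<in> local_rats p" "b \<in> local_rats p"
  then obtain x d y e where ab: "a = of_int x / of_int d" "b = of_int y / of_int e"
    "\<not> int p dvd d" "\<not> int p dvd e" by (metis local_ratE)
  have de: "\<not> int p dvd d * e" using ab p by (simp add: prime_dvd_mult_iff)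
  have nz: "d \<noteq> 0" "e \<noteq> 0" using ab by auto
  have "a - b = of_int (x * e - y * d) / of_int (d * e)" "a * b = of_int (x * y) / of_int (d * e)"
    using nz by (simp_all add: ab diff_frac_eq)
  then show "a - b \<in> local_rats p" "a * b \<in> local_rats p"
    using frac_in_local_rats[OF de] by metis+
qed

lemma ex_prime_power_mult_local:
  assumes "prime p"
  shows "\<exists>k. of_nat p ^ k * q \<in> local_rats p"
proof -
  obtain a d where q: "quotient_of q = (a, d)" by fastforce
  have d: "d > 0" "q = of_int a / of_int d"
    using q quotient_of_denom_pos quotient_of_div by blast+
  have p: "\<not> is_unit (int p)" using assms by auto
  obtain d' where d': "d = int p ^ multiplicity (int p) d * d'" "\<not> int p dvd d'"
    using multiplicity_decompose'[of d "int p"] d(1) p by auto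
  have "of_nat p ^ multiplicity (int p) d * q = of_int a / of_int d'"
    using assms d(1) unfolding d(2) by (subst d'(1)) (auto simp: prime_gt_0_nat)
  then show ?thesis using frac_in_local_rats[OF d'(2)] by metis
qed

lemma rat_mod_zero [simp]: "rat_mod 0 = 0"
  by (simp add: rat_mod_def)

lemma rat_mod_of_int_div:
  assumes "\<not> int CARD('p::prime_card) dvd d"
  shows "rat_mod (of_int a / of_int d) = (of_int a / of_int d :: 'p mod_ring)"
  using rat_mod_frac[OF assms, of a 1] by simp

lemma rat_mod_one [simp]: "rat_mod 1 = (1 :: 'p::prime_card mod_ring)"
  by (simp add: rat_mod_def)

lemma rat_mod_add_mult:
  assumes "a \<in> local_rats CARD('p::prime_card)" "b \<in> local_rats CARD('p)"
  shows rat_mod_add: "rat_mod (a + b) = (rat_mod a + rat_mod b :: 'p mod_ring)"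
    and rat_mod_mult: "rat_mod (a * b) = (rat_mod a * rat_mod b :: 'p mod_ring)"
proof -
  obtain x d y e where ab: "a = of_int x / of_int d" "b = of_int y / of_int e"
    and d: "\<not> int CARD('p) dvd d" and e: "\<not> int CARD('p) dvd e"
    using assms by (metis local_ratE)
  have de: "\<not> int CARD('p) dvd d * e"
    using d e prime_card_int[where 'a = 'p] by (simp add: prime_dvd_mult_iff)
  have nz: "d \<noteq> 0" "e \<noteq> 0" using d e by auto
  have nz': "(of_int d :: 'p mod_ring) \<noteq> 0" "(of_int e :: 'p mod_ring) \<noteq> 0"
    using d e by (simp_all add: of_int_mod_ring_eq_0_iff)
  have s: "a + b = of_int (x * e + y * d) / of_int (d * e)" and m: "a * b = of_int (x * y) / of_int (d * e)"
    using nz by (simp_all add: ab add_frac_eq)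
  show "rat_mod (a + b) = (rat_mod a + rat_mod b :: 'p mod_ring)"
    unfolding s rat_mod_of_int_div[OF de] unfolding ab rat_mod_of_int_div[OF d] rat_mod_of_int_div[OF e]
    using nz' by (simp add: add_frac_eq)
  show "rat_mod (a * b) = (rat_mod a * rat_mod b :: 'p mod_ring)"
    unfolding m rat_mod_of_int_div[OF de] unfolding ab rat_mod_of_int_div[OF d] rat_mod_of_int_div[OF e]
    by simp
qed

text \<open>The kernel of \<open>rat_mod\<close> on the local ring is generated by \<open>p\<close>.\<close>

lemma rat_mod_eq_zero_imp_div_local:
  assumes "q \<in> local_rats CARD('p::prime_card)" "rat_mod q = (0 :: 'p mod_ring)"
  shows "q / of_nat CARD('p) \<in> local_rats CARD('p)"
proof -
  obtain a d where q: "q = of_int a / of_int d" and d: "\<not> int CARD('p) dvd d"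
    using assms(1) by (rule local_ratE)
  have "(of_int d :: 'p mod_ring) \<noteq> 0" using d by (simp add: of_int_mod_ring_eq_0_iff)
  then have "(of_int a :: 'p mod_ring) = 0"
    using assms(2) unfolding q rat_mod_of_int_div[OF d] by simp
  then obtain b where "a = int CARD('p) * b" unfolding of_int_mod_ring_eq_0_iff by blast
  then have "q / of_nat CARD('p) = of_int b / of_int d" by (simp add: q)
  with frac_in_local_rats[OF d] show ?thesis by simp
qed

context
  fixes R :: "rat set"
  defines "R \<equiv> local_rats CARD('p::prime_card)"
begin

interpretation coeff_ring R
  unfolding R_def by (rule coeff_ring_local_rats) (rule prime_card)

lemma rat_mod_R_add: "a \<in> R \<Longrightarrow> b \<in> R \<Longrightarrow> rat_mod (a + b) = (rat_mod a + rat_mod b :: 'p mod_ring)"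
  and rat_mod_R_mult: "a \<in> R \<Longrightarrow> b \<in> R \<Longrightarrow> rat_mod (a * b) = (rat_mod a * rat_mod b :: 'p mod_ring)"
  unfolding R_def by (rule rat_mod_add rat_mod_mult; assumption)+

lemma prime_power_in_R: "of_nat CARD('p) ^ k \<in> R"
  using int_in_local_rats[of "CARD('p)" "int CARD('p) ^ k"] prime_gt_1_nat[OF prime_card[where 'a = 'p]]
  by (simp add: R_def)

lemma rat_mod_sum:
  "(\<And>i. i \<in> A \<Longrightarrow> h i \<in> R) \<Longrightarrow> rat_mod (sum h A) = (\<Sum>i\<in>A. rat_mod (h i) :: 'p mod_ring)"
proof (induction A rule: infinite_finite_induct)
  case (insert a A)
  then have "rat_mod (h a + sum h A) = (rat_mod (h a) + rat_mod (sum h A) :: 'p mod_ring)"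
    using sum_R[of A h] by (intro rat_mod_R_add) auto
  with insert show ?case by simp
qed auto

lemma coeff_poly_mod_p [simp]: "coeff (poly_mod_p q) i = rat_mod (coeff q i)"
  unfolding poly_mod_p_def by (rule coeff_map_poly) simp

lemma poly_mod_p_mult:
  assumes "a \<in> polys_over" "b \<in> polys_over"
  shows "poly_mod_p (a * b) = (poly_mod_p a * poly_mod_p b :: 'p mod_ring poly)"
proof (rule poly_eqI)
  fix n
  have ab: "coeff a i \<in> R" "coeff b i \<in> R" for i using assms by (auto simp: polys_over_def)
  have "rat_mod (coeff (a * b) n) = (\<Sum>i\<le>n. rat_mod (coeff a i * coeff b (n - i)) :: 'p mod_ring)"
    unfolding coeff_mult by (rule rat_mod_sum) (rule mult_R[OF ab])
  also have "\<dots> = (\<Sum>i\<le>n. rat_mod (coeff a i) * rat_mod (coeff b (n - i)))"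
    by (rule sum.cong[OF refl], rule rat_mod_R_mult) (rule ab)+
  finally show "coeff (poly_mod_p (a * b)) n = coeff (poly_mod_p a * poly_mod_p b :: 'p mod_ring poly) n"
    by (simp add: coeff_mult)
qed

lemma poly_mod_p_monic:
  assumes "lead_coeff q = 1"
  shows "lead_coeff (poly_mod_p q :: 'p mod_ring poly) = 1"
    and "degree (poly_mod_p q :: 'p mod_ring poly) = degree q"
    and "poly_mod_p q \<noteq> (0 :: 'p mod_ring poly)"
proof -
  have "degree (poly_mod_p q :: 'p mod_ring poly) \<le> degree q"
    by (rule degree_le) (simp add: coeff_eq_0)
  moreover have "degree q \<le> degree (poly_mod_p q :: 'p mod_ring poly)"
    by (rule le_degree) (simp add: assms)
  ultimately show d: "degree (poly_mod_p q :: 'p mod_ring poly) = degree q"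
    by (rule order_antisym)
  show lc: "lead_coeff (poly_mod_p q :: 'p mod_ring poly) = 1" using assms by (simp add: d)
  show "poly_mod_p q \<noteq> (0 :: 'p mod_ring poly)" using lc by (metis leading_coeff_0_iff zero_neq_one)
qed

text \<open>The least power of \<open>p\<close> that clears the denominators of \<open>q\<close> leaves a non-zero reduction: if
the power is positive by minimality, otherwise because \<open>q\<close> is monic.\<close>

lemma ex_primitive_multiple:
  assumes "lead_coeff q = 1"
  obtains k where "smult (of_nat CARD('p) ^ k) q \<in> polys_over"
    "poly_mod_p (smult (of_nat CARD('p) ^ k) q) \<noteq> (0 :: 'p mod_ring poly)"
    "k = 0 \<longrightarrow> q \<in> polys_over"
proof -
  let ?p = "of_nat CARD('p) :: rat"
  have "\<forall>i. \<exists>k. ?p ^ k * coeff q i \<in> R"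
    unfolding R_def by (intro allI ex_prime_power_mult_local prime_card)
  then obtain e where e: "\<And>i. ?p ^ e i * coeff q i \<in> R" by (metis (no_types))
  define E where "E = (\<Sum>i\<le>degree q. e i)"
  have "?p ^ E * coeff q i \<in> R" for i
  proof (cases "i \<le> degree q")
    case True
    then have "e i \<le> E" unfolding E_def by (intro member_le_sum) auto
    then have "?p ^ E * coeff q i = ?p ^ (E - e i) * (?p ^ e i * coeff q i)"
      by (simp add: power_add[symmetric] mult.assoc[symmetric])
    then show ?thesis using mult_R[OF prime_power_in_R e] by metis
  qed (simp add: coeff_eq_0 zero_R)
  then have ex: "\<exists>k. smult (?p ^ k) q \<in> polys_over" by (auto simp: polys_over_def)
  define k where "k = (LEAST k. smult (?p ^ k) q \<in> polys_over)"
  have k: "smult (?p ^ k) q \<in> polys_over" unfolding k_def using ex by (rule LeastI_ex)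
  have "poly_mod_p (smult (?p ^ k) q) \<noteq> (0 :: 'p mod_ring poly)"
  proof (cases k)
    case 0
    with poly_mod_p_monic(3)[OF assms] show ?thesis by simp
  next
    case (Suc j)
    show ?thesis
    proof
      assume z: "poly_mod_p (smult (?p ^ k) q) = (0 :: 'p mod_ring poly)"
      have "?p ^ j * coeff q i \<in> R" for i
      proof -
        have "rat_mod (?p ^ k * coeff q i) = (0 :: 'p mod_ring)"
          using arg_cong[OF z, of "\<lambda>q. coeff q i"] by simp
        moreover have "?p ^ k * coeff q i \<in> R" using k by (simp add: polys_over_def)
        ultimately have "?p ^ k * coeff q i / ?p \<in> R"
          unfolding R_def by (intro rat_mod_eq_zero_imp_div_local)
        then show ?thesis by (simp add: Suc)
      qed
      then have "smult (?p ^ j) q \<in> polys_over" by (simp add: polys_over_def)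
      then have "k \<le> j" unfolding k_def by (rule Least_le)
      with Suc show False by simp
    qed
  qed
  with k show thesis by (intro that[of k]) auto
qed

text \<open>Gauss's lemma. If \<open>p^k m\<close> and \<open>p^l n\<close> are primitive multiples of the two factors with
\<open>k > 0\<close>, then their product \<open>p^(k+l) h\<close> reduces to 0, although neither of them does.\<close>

lemma monic_factor_over:
  assumes "lead_coeff h = 1" "h \<in> polys_over" "lead_coeff m = 1" "m dvd h"
  shows "m \<in> polys_over"
proof -
  let ?p = "of_nat CARD('p) :: rat"
  obtain n where h: "h = m * n" using assms(4) by blast
  then have n: "lead_coeff n = 1" using assms(1,3) by (simp add: lead_coeff_mult)
  obtain k where k: "smult (?p ^ k) m \<in> polys_over"
    "poly_mod_p (smult (?p ^ k) m) \<noteq> (0 :: 'p mod_ring poly)" "k = 0 \<longrightarrow> m \<in> polys_over"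
    using assms(3) by (rule ex_primitive_multiple)
  obtain l where l: "smult (?p ^ l) n \<in> polys_over"
    "poly_mod_p (smult (?p ^ l) n) \<noteq> (0 :: 'p mod_ring poly)"
    using n by (rule ex_primitive_multiple)
  have "k = 0"
  proof (rule ccontr)
    assume "k \<noteq> 0"
    let ?c = "?p ^ (k + l)"
    have p: "?p = of_int (int CARD('p)) / of_int 1" by simp
    have one: "\<not> int CARD('p) dvd 1" using prime_card_int[where 'a = 'p] by auto
    have "rat_mod ?c = (of_int (int CARD('p) ^ (k + l)) / of_int 1 :: 'p mod_ring)"
      using rat_mod_of_int_div[where 'p = 'p, OF one, of "int CARD('p) ^ (k + l)"] by simp
    also have "\<dots> = 0"
      using \<open>k \<noteq> 0\<close> of_int_mod_ring_eq_0_iff[where 'p = 'p, of "int CARD('p) ^ (k + l)"] by simp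
    finally have c0: "rat_mod ?c = (0 :: 'p mod_ring)" .
    have "coeff h i \<in> R" for i using assms(2) by (simp add: polys_over_def)
    then have "rat_mod (?c * coeff h i) = (0 :: 'p mod_ring)" for i
      using rat_mod_R_mult[OF prime_power_in_R] c0 by simp
    then have "poly_mod_p (smult ?c h) = (0 :: 'p mod_ring poly)" by (intro poly_eqI) simp
    moreover have "smult ?c h = smult (?p ^ k) m * smult (?p ^ l) n"
      by (simp add: h power_add mult.commute)
    ultimately have "poly_mod_p (smult (?p ^ k) m) * poly_mod_p (smult (?p ^ l) n) = (0 :: 'p mod_ring poly)"
      using poly_mod_p_mult[OF k(1) l(1)] by simp
    with k(2) l(2) show False by simp
  qed
  with k(3) show ?thesis by simp
qed

lemma lookup_mpoly_mod [simp]: "Poly_Mapping.lookup (mpoly_mod h) t = rat_mod (Poly_Mapping.lookup h t)"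
  by (simp add: mpoly_mod_def Poly_Mapping.map.rep_eq when_def)

lemma mpoly_mod_zero [simp]: "mpoly_mod 0 = 0"
  by (rule poly_mapping_eqI) simp

lemma mpoly_mod_single [simp]: "mpoly_mod (Poly_Mapping.single t c) = Poly_Mapping.single t (rat_mod c)"
  by (rule poly_mapping_eqI) (simp add: lookup_single when_def)

lemma mpoly_mod_add:
  assumes "a \<in> mpolys_over" "b \<in> mpolys_over"
  shows "mpoly_mod (a + b) = (mpoly_mod a + mpoly_mod b :: ('n, 'p mod_ring) mpoly)"
  using assms[THEN mpolys_overD]
  by (intro poly_mapping_eqI) (simp add: lookup_add rat_mod_R_add)

lemma mpoly_mod_sum:
  assumes "\<And>i. i \<in> A \<Longrightarrow> h i \<in> mpolys_over"
  shows "mpoly_mod (sum h A) = (\<Sum>i\<in>A. mpoly_mod (h i) :: ('n, 'p mod_ring) mpoly)"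
  using assms by (intro poly_mapping_eqI) (simp add: lookup_sum mpolys_over_def rat_mod_sum)

lemma mpoly_mod_mult:
  fixes a b :: "('n, rat) mpoly"
  assumes "a \<in> mpolys_over" "b \<in> mpolys_over"
  shows "mpoly_mod (a * b) = (mpoly_mod a * mpoly_mod b :: ('n, 'p mod_ring) mpoly)"
proof -
  let ?s = "\<lambda>h t. Poly_Mapping.single t (Poly_Mapping.lookup h t) :: ('n, rat) mpoly"
  have over: "?s a s \<in> mpolys_over" "?s b t \<in> mpolys_over" for s t
    using assms by (simp_all add: single_over mpolys_overD)
  have expand: "mpoly_mod h = (\<Sum>t\<in>Poly_Mapping.keys h. mpoly_mod (?s h t) :: ('n, 'p mod_ring) mpoly)"
    if "h \<in> mpolys_over" for h
    using that by (subst mpoly_eq_sum_single[of h], subst mpoly_mod_sum) (auto intro: single_over mpolys_overD)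
  have single: "mpoly_mod (?s a s * ?s b t) = (mpoly_mod (?s a s) * mpoly_mod (?s b t) :: ('n, 'p mod_ring) mpoly)" for s t
    using assms[THEN mpolys_overD] by (simp add: mult_single rat_mod_R_mult)
  have "a * b = (\<Sum>s\<in>Poly_Mapping.keys a. \<Sum>t\<in>Poly_Mapping.keys b. ?s a s * ?s b t)"
    by (subst mpoly_eq_sum_single[of a], subst mpoly_eq_sum_single[of b]) (simp add: sum_product)
  then have "mpoly_mod (a * b) = (\<Sum>s\<in>Poly_Mapping.keys a. \<Sum>t\<in>Poly_Mapping.keys b.
      mpoly_mod (?s a s * ?s b t) :: ('n, 'p mod_ring) mpoly)"
    using over by (simp only:) (simp only: mpoly_mod_sum sum_over mult_over)
  also have "\<dots> = mpoly_mod a * mpoly_mod b"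
    unfolding single expand[OF assms(1)] expand[OF assms(2)] by (simp only: sum_product)
  finally show ?thesis .
qed

lemma eval_at_over_and_mod:
  fixes g :: "('n, rat) mpoly"
  assumes "g \<in> mpolys_over" "q \<in> polys_over"
  shows eval_at_over: "eval_at g q \<in> mpolys_over"
    and mpoly_mod_eval_at: "mpoly_mod (eval_at g q) =
      (eval_at (mpoly_mod g) (poly_mod_p q) :: ('n, 'p mod_ring) mpoly)"
proof -
  have "eval_at g q \<in> mpolys_over \<and>
      mpoly_mod (eval_at g q) = (eval_at (mpoly_mod g) (poly_mod_p q) :: ('n, 'p mod_ring) mpoly)"
    using assms(2)
  proof (induction q)
    case 0
    have "poly_mod_p 0 = (0 :: 'p mod_ring poly)" by (rule poly_eqI) simp
    then show ?case using single_over[OF zero_R, of 0] by simp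
  next
    case (pCons a q)
    have "coeff (pCons a q) 0 \<in> R" "coeff (pCons a q) (Suc i) \<in> R" for i
      using pCons.prems unfolding polys_over_def by blast+
    then have a: "a \<in> R" and q: "q \<in> polys_over" by (simp_all add: polys_over_def)
    note IH = pCons.IH[OF q]
    have c: "(const_mpoly a :: ('n, rat) mpoly) \<in> mpolys_over" using a by (simp add: const_mpoly_def single_over)
    have "poly_mod_p (pCons a q) = (pCons (rat_mod a) (poly_mod_p q) :: 'p mod_ring poly)"
      by (rule poly_eqI) (simp add: coeff_pCons split: nat.split)
    then show ?case
      using IH c assms(1)
      by (simp add: eval_at_pCons add_over mult_over mpoly_mod_add mpoly_mod_mult)
         (simp add: const_mpoly_def)
  qed
  then show "eval_at g q \<in> mpolys_over"
    "mpoly_mod (eval_at g q) = (eval_at (mpoly_mod g) (poly_mod_p q) :: ('n, 'p mod_ring) mpoly)"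
    by auto
qed

lemma mpoly_mod_combinations:
  fixes G :: "('n, rat) mpoly set"
  assumes "G \<subseteq> mpolys_over" "h \<in> combinations G"
  shows "h \<in> mpolys_over \<and> (mpoly_mod h :: ('n, 'p mod_ring) mpoly) \<in> genideal P_ring (mpoly_mod ` G)"
  using assms(2)
proof induction
  interpret ring "P_ring :: ('n, 'p mod_ring) mpoly ring" by (rule ring_P_ring)
  interpret J: mpoly_ideal "genideal P_ring (mpoly_mod ` G) :: ('n, 'p mod_ring) mpoly set"
    by (rule mpoly_ideal.intro, rule genideal_ideal) simp
  {
    case zero
    show ?case using single_over[OF zero_R, of 0] J.zero_mem by simp
  next
    case (step h c g t)
    have g: "g \<in> mpolys_over" using step assms(1) by blast
    have "(mpoly_mod g :: ('n, 'p mod_ring) mpoly) \<in> genideal P_ring (mpoly_mod ` G)"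
      using genideal_self[of "mpoly_mod ` G"] step by auto
    moreover have m: "Poly_Mapping.single t c * g \<in> mpolys_over"
      using g step by (intro mult_over single_over)
    ultimately show ?case
      using step g by (simp add: add_over mpoly_mod_add mpoly_mod_mult single_over J.add_mem J.mult_mem)
  }
qed

lemma mpoly_over_if_not_dvd_den:
  assumes "\<not> int CARD('p) dvd den h"
  shows "h \<in> mpolys_over"
proof -
  have "\<not> int CARD('p) dvd rat_den (Poly_Mapping.lookup h t)" for t
  proof (cases "t \<in> Poly_Mapping.keys h")
    case True
    then have "h \<noteq> 0" by auto
    then have "rat_den (Poly_Mapping.lookup h t) dvd den h"
      using True unfolding den_def by (auto intro!: dvd_Lcm)
    with assms show ?thesis by (meson dvd_trans)
  next
    case False
    then show ?thesis
      using prime_card_int[where 'a = 'p] by (auto simp: rat_den_def in_keys_iff)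
  qed
  then have "Poly_Mapping.lookup h t \<in> R" for t by (simp add: R_def local_rats_def)
  then show ?thesis by (simp add: mpolys_over_def)
qed

lemma usable_prime_imp_over:
  assumes "usable_prime CARD('p) \<sigma> I f"
  shows "f \<in> mpolys_over" "reduced_gb \<sigma> I \<subseteq> mpolys_over"
proof -
  have u: "\<not> int CARD('p) dvd den f" "\<not> int CARD('p) dvd den_ideal \<sigma> I"
    using assms by (auto simp: usable_prime_def)
  show "f \<in> mpolys_over" using u(1) by (rule mpoly_over_if_not_dvd_den)
  have "den g dvd den_ideal \<sigma> I" if "g \<in> reduced_gb \<sigma> I" for g
    unfolding den_ideal_def using that by (auto intro: dvd_Lcm)
  then show "reduced_gb \<sigma> I \<subseteq> mpolys_over"
    using u(2) mpoly_over_if_not_dvd_den dvd_trans by blast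
qed

text \<open>By Gauss's lemma \<open>\<mu>\<close>, a factor of an integral equation, has coefficients in the local ring.
As \<open>\<mu>(f)\<close> lies in the ideal and is over the local ring, it is a combination of the reduced
basis with coefficients in that ring, and this representation can be reduced modulo \<open>p\<close>. So the
reduction of \<open>\<mu>\<close> lies in the kernel that \<open>\<nu>\<close> generates.\<close>

lemma modular_minimal_poly_dvd:
  fixes I :: "('n::finite, rat) mpoly set"
  assumes "ideal I P_ring" "zero_dimensional I" "term_ordering \<sigma>" "usable_prime CARD('p) \<sigma> I f"
  defines "\<mu> \<equiv> minimal_poly f I"
    and "\<nu> \<equiv> (modular_minimal_poly \<sigma> I f :: 'p mod_ring poly)"
  shows "lead_coeff \<nu> = 1" "\<nu> dvd poly_mod_p \<mu>"
    "lead_coeff (poly_mod_p \<mu> :: 'p mod_ring poly) = 1"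
    "degree (poly_mod_p \<mu> :: 'p mod_ring poly) = degree \<mu>" "degree \<mu> \<le> quot_dim I"
proof -
  interpret ordered_ideal \<sigma> I
    by (intro ordered_ideal.intro pp_order.intro mpoly_ideal.intro) fact+
  let ?J = "modular_reduction \<sigma> I :: ('n, 'p mod_ring) mpoly set"
  interpret P: ring "P_ring :: ('n, 'p mod_ring) mpoly ring" by (rule ring_P_ring)
  interpret J: mpoly_ideal ?J
    unfolding modular_reduction_def by (rule mpoly_ideal.intro, rule P.genideal_ideal) simp
  note f = usable_prime_imp_over(1)[OF assms(4)] and G = usable_prime_imp_over(2)[OF assms(4)]
  obtain h where h: "lead_coeff h = 1" "h \<in> polys_over" "eval_at f h \<in> I"
    by (rule ex_integral_equation[OF coeff_ring_axioms assms(2) G f])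
  have "h \<noteq> 0" using h(1) by auto
  have \<mu>: "lead_coeff \<mu> = 1" "\<mu> dvd q \<longleftrightarrow> eval_at f q \<in> I" for q
    unfolding \<mu>_def
    using lead_coeff_minimal_poly[OF \<open>h \<noteq> 0\<close> h(3)] minimal_poly_dvd_iff[OF \<open>h \<noteq> 0\<close> h(3)] by auto
  have "\<mu> \<in> polys_over" using monic_factor_over[OF h(1,2) \<mu>(1)] \<mu>(2) h(3) by blast
  have e: "eval_at f \<mu> \<in> mpolys_over" "mpoly_mod (eval_at f \<mu>) =
      (eval_at (mpoly_mod f) (poly_mod_p \<mu>) :: ('n, 'p mod_ring) mpoly)"
    using eval_at_over_and_mod[OF f \<open>\<mu> \<in> polys_over\<close>] by auto
  have eI: "eval_at f \<mu> \<in> I" using \<mu>(2)[of \<mu>] by simp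
  obtain r where r: "Poly_Mapping.keys r \<subseteq> standard_pps" "eval_at f \<mu> - r \<in> combinations (reduced_gb \<sigma> I)"
    "eval_at f \<mu> - r \<in> I"
    by (rule division_by_reduced_gb[OF coeff_ring_axioms G e(1)])
  \<comment> \<open>The normal form of an element of the ideal vanishes.\<close>
  have "r \<in> I" using minus_mem[OF eI r(3)] by simp
  then have "r = 0" using r(1) by (rule standard_in_ideal_imp_zero)
  with r(2) have "(mpoly_mod (eval_at f \<mu>) :: ('n, 'p mod_ring) mpoly) \<in> ?J"
    using mpoly_mod_combinations[OF G] unfolding modular_reduction_def by simp
  then have ker: "eval_at (mpoly_mod f) (poly_mod_p \<mu>) \<in> ?J" using e(2) by simp
  show monic: "lead_coeff (poly_mod_p \<mu> :: 'p mod_ring poly) = 1"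
    "degree (poly_mod_p \<mu> :: 'p mod_ring poly) = degree \<mu>"
    using poly_mod_p_monic[OF \<mu>(1)] by auto
  note nz = poly_mod_p_monic(3)[OF \<mu>(1)]
  show "lead_coeff \<nu> = 1" "\<nu> dvd poly_mod_p \<mu>"
    using J.lead_coeff_minimal_poly[OF nz ker] J.minimal_poly_dvd_iff[OF nz ker] ker
    by (auto simp: \<nu>_def modular_minimal_poly_def)
  show "degree \<mu> \<le> quot_dim I"
    unfolding \<mu>_def using degree_minimal_poly_le_quot_dim[OF assms(2) \<open>h \<noteq> 0\<close> h(3)] .
qed

end

section \<open>Comparing degrees\<close>

theorem corollary3p21:
  fixes I :: "('n::finite, rat) mpoly set"
    and \<sigma> :: "'n pp rel"
    and f :: "('n, rat) mpoly"
    and \<mu>\<^sub>1 :: "'p1::prime_card mod_ring poly"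
    and \<mu>\<^sub>2 :: "'p2::prime_card mod_ring poly"
  assumes "ideal I P_ring"
    and "zero_dimensional I"
    and "term_ordering \<sigma>"
    and "usable_prime CARD('p1) \<sigma> I f"
    and "usable_prime CARD('p2) \<sigma> I f"
    and "\<mu>\<^sub>1 = modular_minimal_poly \<sigma> I f"
    and "\<mu>\<^sub>2 = modular_minimal_poly \<sigma> I f"
  shows "(degree \<mu>\<^sub>1 < degree \<mu>\<^sub>2 \<longrightarrow> bad_prime TYPE('p1) \<sigma> I f) \<and>
         (degree \<mu>\<^sub>1 = quot_dim I \<longrightarrow> good_prime TYPE('p1) \<sigma> I f)"
proof -
  let ?\<mu> = "minimal_poly f I"
  note p1 = modular_minimal_poly_dvd[OF assms(1-4), folded assms(6)]
  note p2 = modular_minimal_poly_dvd[OF assms(1-3,5), folded assms(7)]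
  have "poly_mod_p ?\<mu> \<noteq> (0 :: 'p2 mod_ring poly)" using p2(3) by (metis leading_coeff_0_iff zero_neq_one)
  then have "degree \<mu>\<^sub>2 \<le> degree ?\<mu>" using dvd_imp_degree_le[OF p2(2)] p2(4) by simp
  then have "\<not> good_prime TYPE('p1) \<sigma> I f" if "degree \<mu>\<^sub>1 < degree \<mu>\<^sub>2"
    using that p1(4) assms(6) by (auto simp: good_prime_def)
  moreover have "\<mu>\<^sub>1 = poly_mod_p ?\<mu>" if deg: "degree \<mu>\<^sub>1 = quot_dim I"
  proof -
    obtain q where q: "poly_mod_p ?\<mu> = \<mu>\<^sub>1 * q" using p1(2) by blast
    have "lead_coeff q = 1" using p1(1,3) by (simp add: q lead_coeff_mult)
    moreover have "degree (\<mu>\<^sub>1 * q) = degree \<mu>\<^sub>1 + degree q"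
      using p1(3) q by (intro degree_mult_eq) auto
    then have "degree q = 0" using p1(4,5) deg by (simp add: q)
    ultimately have "q = 1" by (metis degree_0_id one_pCons)
    with q show ?thesis by simp
  qed
  ultimately show ?thesis
    using assms(4,6) by (auto simp: bad_prime_def good_prime_def)
qed

end
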